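(* Let $k\ge1$ and $m\ge k+1$, $n\ge2$. Let $K_{m,n}$ have bipartition $(U,W)$ with $U=\{u_1,\dots,u_m\}$, $W=\{w_1,\dots,w_n\}$. Then the generic $(k,1)$-rigidity matroid ${\mathcal R}^{k,1}_{m,n}$ is the unique maximal (in the weak order) rooted $K_{k+1,2}$-matroid on $K_{m,n}$, where rooted copies of $K_{k+1,2}$ are those whose side of size $k+1$ lies in $U$ and whose side of size $2$ lies in $W$.
   Context: For $p:U\to{\mathbb R}^k$ and $q:W\to{\mathbb R}^\ell$, the $(k,\ell)$-rigidity matrix $R^{k,\ell}(K_{m,n},p,q)$ has $|E(K_{m,n})|$ rows and $\ell m+kn$ columns; each $u_i\in U$ labels $\ell$ consecutive columns among the first $\ell m$, each $w_j\in W$ labels $k$ consecutive columns among the last $kn$, and the row of edge $u_iw_j$ has $q(w_j)$ in the columns of $u_i$, $p(u_i)$ in the columns of $w_j$, and zeros elsewhere. ${\mathcal R}^{k,\ell}_{m,n}$ is the row matroid of this matrix for generic $p,q$ (coordinates algebraically independent over ${\mathbb Q}$). For a bipartite graph $H$ with ordered bipartition $(A,B)$, a rooted copy of $H$ in $K_{m,n}$ is a subgraph $H'$ with an isomorphism $\theta:H\to H'$ such that $\theta(A)\subseteq U$, $\theta(B)\subseteq W$; a rooted $H$-matroid on $K_{m,n}$ is a matroid on $E(K_{m,n})$ in which the edge set of every rooted copy of $H$ is a circuit. Weak order: ${\mathcal M}_1\preceq{\mathcal M}_2$ if every independent set of ${\mathcal M}_1$ is independent in ${\mathcal M}_2$.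 *)

theory Defs
  imports Complex_Main "HOL-Library.Poly_Mapping"
begin

text \<open>A matroid on a ground set \<open>E\<close> is represented by its family \<open>\<I>\<close> of independent sets.\<close>

definition matroid_on :: "'a set \<Rightarrow> 'a set set \<Rightarrow> bool" where
  "matroid_on E \<I> \<longleftrightarrow>
     finite E \<and> (\<forall>X\<in>\<I>. X \<subseteq> E) \<and> {} \<in> \<I> \<and>
     (\<forall>X\<in>\<I>. \<forall>Y\<subseteq>X. Y \<in> \<I>) \<and>
     (\<forall>X\<in>\<I>. \<forall>Y\<in>\<I>. card X < card Y \<longrightarrow> (\<exists>e\<in>Y - X. insert e X \<in> \<I>))"

definition circuit_of :: "'a set \<Rightarrow> 'a set set \<Rightarrow> 'a set \<Rightarrow> bool" where
  "circuit_of E \<I> C \<longleftrightarrow> C \<subseteq> E \<and> C \<notin> \<I> \<and> (\<forall>D. D \<subset> C \<longrightarrow> D \<in> \<I>)"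

definition weak_le :: "'a set set \<Rightarrow> 'a set set \<Rightarrow> bool" where
  "weak_le \<I>\<^sub>1 \<I>\<^sub>2 \<longleftrightarrow> (\<forall>X\<in>\<I>\<^sub>1. X \<in> \<I>\<^sub>2)"

definition weak_maximal :: "('a set set \<Rightarrow> bool) \<Rightarrow> 'a set set \<Rightarrow> bool" where
  "weak_maximal P \<I> \<longleftrightarrow> P \<I> \<and> (\<forall>\<J>. P \<J> \<and> weak_le \<I> \<J> \<longrightarrow> \<J> = \<I>)"

definition unique_weak_maximal :: "('a set set \<Rightarrow> bool) \<Rightarrow> 'a set set \<Rightarrow> bool" where
  "unique_weak_maximal P \<I> \<longleftrightarrow>
     weak_maximal P \<I> \<and> (\<forall>\<J>. weak_maximal P \<J> \<longrightarrow> \<J> = \<I>)"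


text \<open>
  The vertices \<open>u\<^sub>i\<close> and \<open>w\<^sub>j\<close> are represented by their indices, counted from 0; the pair
  \<open>(i, j)\<close> is the edge \<open>u\<^sub>iw\<^sub>j\<close>.
\<close>

definition K_edges :: "nat \<Rightarrow> nat \<Rightarrow> (nat \<times> nat) set" where
  "K_edges m n = {..<m} \<times> {..<n}"

text \<open>
  Here \<open>H\<close> is given by its ordered bipartition \<open>(A, B)\<close> and its edge set \<open>F \<subseteq> A \<times> B\<close>, and
  \<open>C\<close> is the edge set of the copy. The isomorphism is given by its restrictions \<open>f\<close> to \<open>A\<close> and
  \<open>g\<close> to \<open>B\<close>; as the host graph is complete bipartite, any two such injections define a
  subgraph of it.
\<close>

definition rooted_copy_edges ::
  "'a set \<Rightarrow> 'b set \<Rightarrow> ('a \<times> 'b) set \<Rightarrow> nat \<Rightarrow> nat \<Rightarrow> (nat \<times> nat) set \<Rightarrow> bool" where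
  "rooted_copy_edges A B F m n C \<longleftrightarrow>
     (\<exists>f g. inj_on f A \<and> f ` A \<subseteq> {..<m} \<and> inj_on g B \<and> g ` B \<subseteq> {..<n} \<and>
            C = map_prod f g ` F)"

definition rooted_matroid ::
  "'a set \<Rightarrow> 'b set \<Rightarrow> ('a \<times> 'b) set \<Rightarrow> nat \<Rightarrow> nat \<Rightarrow> (nat \<times> nat) set set \<Rightarrow> bool" where
  "rooted_matroid A B F m n \<I> \<longleftrightarrow>
     matroid_on (K_edges m n) \<I> \<and>
     (\<forall>C. rooted_copy_edges A B F m n C \<longrightarrow> circuit_of (K_edges m n) \<I> C)"

definition rooted_K_matroid ::
  "nat \<Rightarrow> nat \<Rightarrow> nat \<Rightarrow> nat \<Rightarrow> (nat \<times> nat) set set \<Rightarrow> bool" where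
  "rooted_K_matroid s t m n = rooted_matroid {..<s} {..<t} (K_edges s t) m n"


text \<open>
  An element of \<open>('i \<Rightarrow>\<^sub>0 nat) \<Rightarrow>\<^sub>0 rat\<close> is a polynomial over the rationals in variables indexed by
  \<open>'i\<close>: it maps each monomial, given by its exponents, to its coefficient.
\<close>

definition rat_mpoly_eval :: "('i \<Rightarrow> real) \<Rightarrow> (('i \<Rightarrow>\<^sub>0 nat) \<Rightarrow>\<^sub>0 rat) \<Rightarrow> real" where
  "rat_mpoly_eval x P =
     (\<Sum>\<alpha>\<in>Poly_Mapping.keys P. of_rat (Poly_Mapping.lookup P \<alpha>) *
        (\<Prod>i\<in>Poly_Mapping.keys \<alpha>. x i ^ Poly_Mapping.lookup \<alpha> i))"

definition alg_indep_over_rat :: "'i set \<Rightarrow> ('i \<Rightarrow> real) \<Rightarrow> bool" where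
  "alg_indep_over_rat I x \<longleftrightarrow>
     (\<forall>P. (\<forall>\<alpha>\<in>Poly_Mapping.keys P. Poly_Mapping.keys \<alpha> \<subseteq> I) \<and> rat_mpoly_eval x P = 0
          \<longrightarrow> P = 0)"

text \<open>
  \<open>p i a\<close> for \<open>i < m\<close>, \<open>a < k\<close> is the \<open>a\<close>-th coordinate of the point \<open>p(u\<^sub>i)\<close> of real \<open>k\<close>-space, and
  \<open>q j b\<close> for \<open>j < n\<close>, \<open>b < l\<close> is the \<open>b\<close>-th coordinate of the point \<open>q(w\<^sub>j)\<close> of real \<open>l\<close>-space; values
  at other arguments are irrelevant.
\<close>

definition generic_pair ::
  "nat \<Rightarrow> nat \<Rightarrow> nat \<Rightarrow> nat \<Rightarrow> (nat \<Rightarrow> nat \<Rightarrow> real) \<Rightarrow> (nat \<Rightarrow> nat \<Rightarrow> real) \<Rightarrow> bool" where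
  "generic_pair k l m n p q \<longleftrightarrow>
     alg_indep_over_rat (({..<m} \<times> {..<k}) <+> ({..<n} \<times> {..<l}))
       (case_sum (\<lambda>(i, a). p i a) (\<lambda>(j, b). q j b))"

text \<open>
  Entry in row \<open>(i, j)\<close> and column \<open>c < l * m + k * n\<close>. The columns of \<open>u\<^sub>i\<close> are
  \<open>l * i, \<dots>, l * i + l - 1\<close>, those of \<open>w\<^sub>j\<close> are \<open>l * m + k * j, \<dots>, l * m + k * j + k - 1\<close>.
\<close>

definition rigidity_matrix ::
  "nat \<Rightarrow> nat \<Rightarrow> nat \<Rightarrow> (nat \<Rightarrow> nat \<Rightarrow> real) \<Rightarrow> (nat \<Rightarrow> nat \<Rightarrow> real) \<Rightarrow> nat \<times> nat \<Rightarrow> nat \<Rightarrow> real"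
  where
  "rigidity_matrix k l m p q = (\<lambda>(i, j) c.
     if c < l * m
     then (if c div l = i then q j (c mod l) else 0)
     else (if (c - l * m) div k = j then p i ((c - l * m) mod k) else 0))"

definition rows_independent :: "('r \<Rightarrow> nat \<Rightarrow> real) \<Rightarrow> nat \<Rightarrow> 'r set \<Rightarrow> bool" where
  "rows_independent M N F \<longleftrightarrow>
     (\<forall>s. (\<forall>c<N. (\<Sum>e\<in>F. s e * M e c) = 0) \<longrightarrow> (\<forall>e\<in>F. s e = 0))"

definition rigidity_matroid ::
  "nat \<Rightarrow> nat \<Rightarrow> nat \<Rightarrow> nat \<Rightarrow> (nat \<Rightarrow> nat \<Rightarrow> real) \<Rightarrow> (nat \<Rightarrow> nat \<Rightarrow> real) \<Rightarrow> (nat \<times> nat) set set" where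
  "rigidity_matroid k l m n p q =
     {F. F \<subseteq> K_edges m n \<and> rows_independent (rigidity_matrix k l m p q) (l * m + k * n) F}"

end

theory Submission
  imports Defs "Jordan_Normal_Form.Determinant"
begin

text \<open>
  Both halves go through the count \<open>|F \<inter> (X \<times> Y)| \<le> |X| + k |Y| - k\<close> for \<open>|X| \<ge> k\<close>, \<open>Y \<noteq> {}\<close>.

  In any rooted \<open>K\<^bsub>k+1,2\<^esub>\<close>-matroid the set \<open>X \<times> Y\<close> is spanned by \<open>X\<^sub>0 \<times> Y \<union> X \<times> {y\<^sub>0}\<close> with
  \<open>|X\<^sub>0| = k\<close>, since every further edge closes a copy of \<open>K\<^bsub>k+1,2\<^esub>\<close>; hence independent sets satisfy
  the count.

  Conversely, the count implies independence for generic \<open>p\<close>. As being independent is the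
  non-vanishing of a Gram determinant, a rational polynomial in \<open>p, q\<close>, one suitable \<open>p\<close> is enough.
  Up to the scaling by \<open>q\<close>, a stress is a family of vectors \<open>v\<^sub>j\<close> in the kernel \<open>L\<close> of \<open>p\<close> with sum
  zero and \<open>v\<^sub>j\<close> supported on the neighbourhood \<open>A\<^sub>j\<close> of \<open>w\<^sub>j\<close>. Instead of \<open>p\<close> one chooses \<open>L\<close>, as the
  row space of a matrix with \<open>m - k\<close> rows of which \<open>|A\<^sub>j| - k\<close> have support in \<open>A\<^sub>j\<close> and which is
  otherwise generic. By the count and Hall's theorem the necessary minors do not vanish, so that the
  vectors of \<open>L\<close> supported on \<open>A\<^sub>j\<close> are spanned by the rows belonging to \<open>j\<close>, and the rows are
  independent. Thus all stresses vanish.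
\<close>

section \<open>Rational polynomial functions\<close>

text \<open>Encoded as a closure instead of by coefficients: determinants of matrices with such
  entries then need only the closure rules, and restriction to a line and representation by a formal
  polynomial become inductions.\<close>

inductive rat_poly_fun :: "'i set \<Rightarrow> (('i \<Rightarrow> real) \<Rightarrow> real) \<Rightarrow> bool" for I where
  const: "rat_poly_fun I (\<lambda>x. of_rat c)"
| var: "i \<in> I \<Longrightarrow> rat_poly_fun I (\<lambda>x. x i)"
| add: "rat_poly_fun I f \<Longrightarrow> rat_poly_fun I g \<Longrightarrow> rat_poly_fun I (\<lambda>x. f x + g x)"
| mult: "rat_poly_fun I f \<Longrightarrow> rat_poly_fun I g \<Longrightarrow> rat_poly_fun I (\<lambda>x. f x * g x)"

lemma rat_poly_fun_0: "rat_poly_fun I (\<lambda>x. 0)"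
  using rat_poly_fun.const[of I 0] by simp

lemma rat_poly_fun_1: "rat_poly_fun I (\<lambda>x. 1)"
  using rat_poly_fun.const[of I 1] by simp

lemma rat_poly_fun_if:
  "(b \<Longrightarrow> rat_poly_fun I f) \<Longrightarrow> (\<not> b \<Longrightarrow> rat_poly_fun I g) \<Longrightarrow>
     rat_poly_fun I (\<lambda>x. if b then f x else g x)"
  by (cases b) simp_all

lemma rat_poly_fun_sum:
  "(\<And>a. a \<in> A \<Longrightarrow> rat_poly_fun I (f a)) \<Longrightarrow> rat_poly_fun I (\<lambda>x. \<Sum>a\<in>A. f a x)"
  by (induction A rule: infinite_finite_induct) (auto intro: rat_poly_fun_0 rat_poly_fun.add)

lemma rat_poly_fun_prod:
  "(\<And>a. a \<in> A \<Longrightarrow> rat_poly_fun I (f a)) \<Longrightarrow> rat_poly_fun I (\<lambda>x. \<Prod>a\<in>A. f a x)"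
  by (induction A rule: infinite_finite_induct) (auto intro: rat_poly_fun_1 rat_poly_fun.mult)

lemma rat_poly_fun_det:
  assumes "\<And>a b. a < d \<Longrightarrow> b < d \<Longrightarrow> rat_poly_fun I (\<lambda>x. A x a b)"
  shows "rat_poly_fun I (\<lambda>x. det (mat d d (\<lambda>(a, b). A x a b)))"
proof -
  have less: "\<pi> a < d" if "\<pi> permutes {0..<d}" "a < d" for \<pi> a
    using permutes_in_image[OF that(1), of a] that(2) by simp
  have "rat_poly_fun I (\<lambda>x. \<Sum>\<pi> | \<pi> permutes {0..<d}.
          of_rat (signof \<pi>) * (\<Prod>a = 0..<d. A x a (\<pi> a)))"
    by (intro rat_poly_fun_sum rat_poly_fun.mult rat_poly_fun.const rat_poly_fun_prod assms)
      (simp_all add: less)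
  moreover have "det (mat d d (\<lambda>(a, b). A x a b)) = (\<Sum>\<pi> | \<pi> permutes {0..<d}.
          of_rat (signof \<pi>) * (\<Prod>a = 0..<d. A x a (\<pi> a)))" for x
    unfolding det_def by (auto simp: less sign_def intro!: sum.cong prod.cong)
  ultimately show ?thesis by simp
qed

lemma rat_poly_fun_along_line:
  assumes "rat_poly_fun I f"
  shows "\<exists>P. \<forall>t. f (\<lambda>i. x i + t * v i) = poly P t"
  using assms
proof induction
  case (const c)
  show ?case by (rule exI[of _ "[:of_rat c:]"]) simp
next
  case (var i)
  show ?case by (rule exI[of _ "[:x i, v i:]"]) simp
next
  case (add f g)
  then obtain P Q where "\<forall>t. f (\<lambda>i. x i + t * v i) = poly P t"
    "\<forall>t. g (\<lambda>i. x i + t * v i) = poly Q t" by blast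
  then show ?case by (intro exI[of _ "P + Q"]) simp
next
  case (mult f g)
  then obtain P Q where "\<forall>t. f (\<lambda>i. x i + t * v i) = poly P t"
    "\<forall>t. g (\<lambda>i. x i + t * v i) = poly Q t" by blast
  then show ?case by (intro exI[of _ "P * Q"]) simp
qed

text \<open>Join a common non-zero of the earlier functions to a non-zero of the new one by a line.
  Along it every function is a univariate polynomial that is non-zero at parameter 0 or 1, so only
  finitely many parameters are bad.\<close>

lemma rat_poly_fun_common_nonzero:
  assumes "finite S" and "\<And>f. f \<in> S \<Longrightarrow> rat_poly_fun I f" and "\<And>f. f \<in> S \<Longrightarrow> \<exists>x. f x \<noteq> 0"
  shows "\<exists>x. \<forall>f\<in>S. f x \<noteq> 0"
  using assms
proof (induction S)
  case empty
  show ?case by simp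
next
  case (insert g S)
  have "\<exists>x. \<forall>f\<in>S. f x \<noteq> 0"
    by (rule insert.IH) (rule insert.prems, simp)+
  then obtain x where x: "\<forall>f\<in>S. f x \<noteq> 0" by blast
  have "\<exists>y. g y \<noteq> 0" by (rule insert.prems) simp
  then obtain y where y: "g y \<noteq> 0" by blast
  have "\<exists>P. \<forall>t. f (\<lambda>i. x i + t * (y i - x i)) = poly P t" if "f \<in> insert g S" for f
    by (rule rat_poly_fun_along_line) (rule insert.prems(1)[OF that])
  then obtain P where P: "\<And>f t. f \<in> insert g S \<Longrightarrow> f (\<lambda>i. x i + t * (y i - x i)) = poly (P f) t"
    by metis
  have nz: "P f \<noteq> 0" if "f \<in> insert g S" for f
  proof (cases "f = g")
    case True
    then show ?thesis using P[OF that, of 1] y by auto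
  next
    case False
    then show ?thesis using P[OF that, of 0] x that by auto
  qed
  have "finite (\<Union>f\<in>insert g S. {t. poly (P f) t = 0})"
    using insert.hyps(1) nz by (intro finite_UN_I poly_roots_finite) simp_all
  then obtain t where t: "t \<notin> (\<Union>f\<in>insert g S. {t. poly (P f) t = 0})"
    using ex_new_if_finite[OF infinite_UNIV_char_0] by blast
  have "f (\<lambda>i. x i + t * (y i - x i)) \<noteq> 0" if "f \<in> insert g S" for f
    unfolding P[OF that] using t that by blast
  then show ?case by blast
qed

section \<open>Transfer to algebraically independent points\<close>

lemma rat_mpoly_eval_superset:
  assumes "finite K" and "Poly_Mapping.keys P \<subseteq> K"
  shows "rat_mpoly_eval x P = (\<Sum>\<alpha>\<in>K. of_rat (Poly_Mapping.lookup P \<alpha>) *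
        (\<Prod>i\<in>Poly_Mapping.keys \<alpha>. x i ^ Poly_Mapping.lookup \<alpha> i))"
  unfolding rat_mpoly_eval_def using assms
  by (intro sum.mono_neutral_left) (auto simp: in_keys_iff)

lemma rat_mpoly_eval_add: "rat_mpoly_eval x (P + Q) = rat_mpoly_eval x P + rat_mpoly_eval x Q"
proof -
  let ?K = "Poly_Mapping.keys P \<union> Poly_Mapping.keys Q"
  have "Poly_Mapping.keys (P + Q) \<subseteq> ?K" by (rule Poly_Mapping.keys_add)
  then show ?thesis
    by (simp add: rat_mpoly_eval_superset[of ?K] lookup_add of_rat_add distrib_right sum.distrib)
qed

lemma monomial_prod_superset:
  fixes x :: "'i \<Rightarrow> real"
  assumes "finite K" and "Poly_Mapping.keys \<alpha> \<subseteq> K"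
  shows "(\<Prod>i\<in>Poly_Mapping.keys \<alpha>. x i ^ Poly_Mapping.lookup \<alpha> i)
       = (\<Prod>i\<in>K. x i ^ Poly_Mapping.lookup \<alpha> i)"
  using assms by (intro prod.mono_neutral_left) (auto simp: in_keys_iff)

lemma monomial_prod_add:
  fixes x :: "'i \<Rightarrow> real" and \<alpha> \<beta> :: "'i \<Rightarrow>\<^sub>0 nat"
  shows "(\<Prod>i\<in>Poly_Mapping.keys (\<alpha> + \<beta>). x i ^ Poly_Mapping.lookup (\<alpha> + \<beta>) i)
       = (\<Prod>i\<in>Poly_Mapping.keys \<alpha>. x i ^ Poly_Mapping.lookup \<alpha> i) *
         (\<Prod>i\<in>Poly_Mapping.keys \<beta>. x i ^ Poly_Mapping.lookup \<beta> i)"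
proof -
  let ?K = "Poly_Mapping.keys \<alpha> \<union> Poly_Mapping.keys \<beta>"
  have sub: "Poly_Mapping.keys (\<alpha> + \<beta>) \<subseteq> ?K" by (rule Poly_Mapping.keys_add)
  have K: "finite ?K" by simp
  show ?thesis
    unfolding monomial_prod_superset[OF K sub] monomial_prod_superset[OF K Un_upper1]
      monomial_prod_superset[OF K Un_upper2]
    by (simp add: lookup_add power_add prod.distrib)
qed

lemma rat_mpoly_eval_single:
  "rat_mpoly_eval x (Poly_Mapping.single \<alpha> c) =
     of_rat c * (\<Prod>i\<in>Poly_Mapping.keys \<alpha>. x i ^ Poly_Mapping.lookup \<alpha> i)"
  by (simp add: rat_mpoly_eval_superset[of "{\<alpha>}"])

definition rat_mpoly_in :: "'i set \<Rightarrow> (('i \<Rightarrow>\<^sub>0 nat) \<Rightarrow>\<^sub>0 rat) \<Rightarrow> bool" where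
  "rat_mpoly_in I P \<longleftrightarrow> (\<forall>\<alpha>\<in>Poly_Mapping.keys P. Poly_Mapping.keys \<alpha> \<subseteq> I)"

lemma rat_mpoly_in_add: "rat_mpoly_in I P \<Longrightarrow> rat_mpoly_in I Q \<Longrightarrow> rat_mpoly_in I (P + Q)"
  unfolding rat_mpoly_in_def using Poly_Mapping.keys_add[of P Q] by blast

lemma rat_mpoly_eval_sum_represented:
  assumes "finite A" and "\<And>a. a \<in> A \<Longrightarrow> \<exists>P. rat_mpoly_in I P \<and> (\<forall>x. f a x = rat_mpoly_eval x P)"
  shows "\<exists>P. rat_mpoly_in I P \<and> (\<forall>x. (\<Sum>a\<in>A. f a x) = rat_mpoly_eval x P)"
  using assms
proof (induction A)
  case empty
  show ?case
    by (rule exI[of _ 0]) (simp add: rat_mpoly_in_def rat_mpoly_eval_def)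
next
  case (insert a A)
  obtain P where "rat_mpoly_in I P" "\<forall>x. (\<Sum>a\<in>A. f a x) = rat_mpoly_eval x P"
    using insert by blast
  moreover obtain Q where "rat_mpoly_in I Q" "\<forall>x. f a x = rat_mpoly_eval x Q"
    using insert(4)[of a] by blast
  ultimately show ?case
    using insert(1,2) by (intro exI[of _ "Q + P"]) (simp add: rat_mpoly_in_add rat_mpoly_eval_add)
qed

lemma rat_poly_fun_represented:
  assumes "rat_poly_fun I f"
  shows "\<exists>P. rat_mpoly_in I P \<and> (\<forall>x. f x = rat_mpoly_eval x P)"
  using assms
proof induction
  case (const c)
  show ?case
    by (rule exI[of _ "Poly_Mapping.single 0 c"])
      (simp add: rat_mpoly_in_def rat_mpoly_eval_single)
next
  case (var i)
  then show ?case
    by (intro exI[of _ "Poly_Mapping.single (Poly_Mapping.single i 1) 1"])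
      (simp add: rat_mpoly_in_def rat_mpoly_eval_single)
next
  case (add f g)
  then obtain P Q where "rat_mpoly_in I P" "\<forall>x. f x = rat_mpoly_eval x P"
    "rat_mpoly_in I Q" "\<forall>x. g x = rat_mpoly_eval x Q" by blast
  then show ?case by (intro exI[of _ "P + Q"]) (simp add: rat_mpoly_in_add rat_mpoly_eval_add)
next
  case (mult f g)
  then obtain P Q where P: "rat_mpoly_in I P" "\<And>x. f x = rat_mpoly_eval x P"
    and Q: "rat_mpoly_in I Q" "\<And>x. g x = rat_mpoly_eval x Q" by blast
  \<comment> \<open>The product expands into one term per pair of monomials. Different pairs may
    give the same monomial, so the terms are added as polynomials and no coefficient of the product
    is computed.\<close>
  let ?c = "\<lambda>(\<alpha>, \<beta>). Poly_Mapping.lookup P \<alpha> * Poly_Mapping.lookup Q \<beta>"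
  let ?t = "\<lambda>e x. rat_mpoly_eval x (Poly_Mapping.single (fst e + snd e) (?c e))"
  have "f x * g x = (\<Sum>e\<in>Poly_Mapping.keys P \<times> Poly_Mapping.keys Q. ?t e x)" for x
    unfolding P(2) Q(2) rat_mpoly_eval_def[of x P] rat_mpoly_eval_def[of x Q] sum_product
      sum.cartesian_product
    by (intro sum.cong)
      (auto simp: rat_mpoly_eval_single monomial_prod_add of_rat_mult mult_ac)
  moreover have "\<exists>R. rat_mpoly_in I R \<and> (\<forall>x. ?t e x = rat_mpoly_eval x R)"
    if "e \<in> Poly_Mapping.keys P \<times> Poly_Mapping.keys Q" for e
  proof (intro exI conjI allI)
    have "Poly_Mapping.keys (fst e) \<subseteq> I" "Poly_Mapping.keys (snd e) \<subseteq> I"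
      using that P(1) Q(1) unfolding rat_mpoly_in_def by auto
    then have "Poly_Mapping.keys (fst e + snd e) \<subseteq> I"
      using Poly_Mapping.keys_add[of "fst e" "snd e"] by blast
    then show "rat_mpoly_in I (Poly_Mapping.single (fst e + snd e) (?c e))"
      unfolding rat_mpoly_in_def by simp
  qed (rule refl)
  then have "\<exists>R. rat_mpoly_in I R \<and> (\<forall>x. (\<Sum>e\<in>Poly_Mapping.keys P \<times> Poly_Mapping.keys Q. ?t e x)
      = rat_mpoly_eval x R)"
    by (intro rat_mpoly_eval_sum_represented) simp_all
  ultimately show ?case by simp
qed

text \<open>Vanishing at an algebraically independent point makes the representing polynomial zero,
  hence the function zero everywhere. One special non-zero therefore settles all generic
  points.\<close>

lemma rat_poly_fun_nonzero_at_alg_indep: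
  assumes "rat_poly_fun I f" and "f y \<noteq> 0" and "alg_indep_over_rat I x"
  shows "f x \<noteq> 0"
proof
  assume "f x = 0"
  obtain P where P: "rat_mpoly_in I P" "\<forall>x. f x = rat_mpoly_eval x P"
    using rat_poly_fun_represented[OF assms(1)] by blast
  then have "P = 0"
    using assms(3) \<open>f x = 0\<close> unfolding alg_indep_over_rat_def rat_mpoly_in_def by simp
  then show False using P(2) assms(2) by (simp add: rat_mpoly_eval_def)
qed

section \<open>Independent rows\<close>

lemma rows_independent_reindex:
  assumes "bij_betw h D F"
  shows "rows_independent M N F \<longleftrightarrow> rows_independent (\<lambda>a. M (h a)) N D"
proof
  assume L: "rows_independent M N F"
  show "rows_independent (\<lambda>a. M (h a)) N D"
    unfolding rows_independent_def
  proof (intro allI impI)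
    fix s assume s: "\<forall>c<N. (\<Sum>a\<in>D. s a * M (h a) c) = 0"
    have "(\<Sum>e\<in>F. s (the_inv_into D h e) * M e c) = (\<Sum>a\<in>D. s a * M (h a) c)" for c
      using assms unfolding sum.reindex_bij_betw[OF assms, symmetric]
      by (intro sum.cong) (auto simp: bij_betw_def the_inv_into_f_f)
    then have "\<forall>e\<in>F. s (the_inv_into D h e) = 0"
      using L s unfolding rows_independent_def
      by (elim allE[of _ "\<lambda>e. s (the_inv_into D h e)"]) simp
    then show "\<forall>a\<in>D. s a = 0"
      using assms unfolding bij_betw_def by (metis imageI the_inv_into_f_f)
  qed
next
  assume R: "rows_independent (\<lambda>a. M (h a)) N D"
  show "rows_independent M N F"
    unfolding rows_independent_def
  proof (intro allI impI)
    fix s assume "\<forall>c<N. (\<Sum>e\<in>F. s e * M e c) = 0"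
    then have "\<forall>c<N. (\<Sum>a\<in>D. s (h a) * M (h a) c) = 0"
      using sum.reindex_bij_betw[OF assms, where g = "\<lambda>e. s e * M e _"] by simp
    then have "\<forall>a\<in>D. s (h a) = 0"
      using R unfolding rows_independent_def by (elim allE[of _ "\<lambda>a. s (h a)"]) simp
    then show "\<forall>e\<in>F. s e = 0" using assms by (metis bij_betw_def imageE)
  qed
qed

text \<open>The kernel of the Gram matrix consists of the row relations: \<open>s\<close> paired
  with its image is the sum of the squares of the entries of the row combination, which over the
  reals vanishes only if all entries do.\<close>

lemma rows_independent_iff_gram_det:
  "rows_independent M N {0..<d} \<longleftrightarrow>
     det (mat d d (\<lambda>(a, b). \<Sum>c<N. M a c * M b c)) \<noteq> 0" (is "_ \<longleftrightarrow> det ?G \<noteq> 0")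
proof -
  have G: "?G \<in> carrier_mat d d" by simp
  have gram: "(?G *\<^sub>v vec d s) $ a = (\<Sum>c<N. M a c * (\<Sum>b = 0..<d. s b * M b c))"
    if "a < d" for s a
  proof -
    have "(?G *\<^sub>v vec d s) $ a = (\<Sum>b = 0..<d. (\<Sum>c<N. M a c * M b c) * s b)"
      using that by (simp add: scalar_prod_def)
    also have "\<dots> = (\<Sum>c<N. M a c * (\<Sum>b = 0..<d. s b * M b c))"
      unfolding sum_distrib_left sum_distrib_right
      by (subst sum.swap) (simp add: mult_ac)
    finally show ?thesis .
  qed
  have quad: "(\<Sum>a = 0..<d. s a * (?G *\<^sub>v vec d s) $ a) = (\<Sum>c<N. (\<Sum>b = 0..<d. s b * M b c)\<^sup>2)"
    for s
  proof -
    have "(\<Sum>a = 0..<d. s a * (?G *\<^sub>v vec d s) $ a)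
        = (\<Sum>a = 0..<d. \<Sum>c<N. s a * M a c * (\<Sum>b = 0..<d. s b * M b c))"
      by (intro sum.cong refl) (subst gram, auto simp: sum_distrib_left mult_ac)
    also have "\<dots> = (\<Sum>c<N. (\<Sum>b = 0..<d. s b * M b c)\<^sup>2)"
      by (subst sum.swap) (simp add: sum_distrib_right power2_eq_square)
    finally show ?thesis .
  qed
  show ?thesis
  proof
    assume L: "rows_independent M N {0..<d}"
    show "det ?G \<noteq> 0"
    proof
      assume "det ?G = 0"
      then obtain v where v: "v \<in> carrier_vec d" "v \<noteq> 0\<^sub>v d" "?G *\<^sub>v v = 0\<^sub>v d"
        using det_0_iff_vec_prod_zero_field[OF G] by blast
      define s where "s b = v $ b" for b
      have vs: "v = vec d s" using v(1) unfolding s_def by auto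
      have "(\<Sum>c<N. (\<Sum>b = 0..<d. s b * M b c)\<^sup>2) = 0"
        unfolding quad[symmetric] vs[symmetric] v(3) by simp
      then have "\<forall>c<N. (\<Sum>b = 0..<d. s b * M b c) = 0"
        by (subst (asm) sum_nonneg_eq_0_iff) auto
      then have "\<forall>b\<in>{0..<d}. s b = 0" using L unfolding rows_independent_def by blast
      then have "v = 0\<^sub>v d" unfolding vs by auto
      then show False using v(2) by simp
    qed
  next
    assume R: "det ?G \<noteq> 0"
    show "rows_independent M N {0..<d}"
      unfolding rows_independent_def
    proof (intro allI impI)
      fix s assume "\<forall>c<N. (\<Sum>b = 0..<d. s b * M b c) = 0"
      then have "?G *\<^sub>v vec d s = 0\<^sub>v d"
        by (intro eq_vecI) (simp_all add: gram del: index_mult_mat_vec)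
      then have "vec d s = 0\<^sub>v d"
        using R det_0_iff_vec_prod_zero_field[OF G] vec_carrier by blast
      then show "\<forall>b\<in>{0..<d}. s b = 0"
        by (metis atLeastLessThan_iff index_vec index_zero_vec(1))
    qed
  qed
qed

text \<open>The Gram determinant captures independence of the rows of a rectangular matrix by a
  single polynomial, with no choice of a minor.\<close>

lemma rows_independent_rat_poly_fun:
  assumes "finite F" and "\<And>e c. e \<in> F \<Longrightarrow> c < N \<Longrightarrow> rat_poly_fun I (\<lambda>x. M x e c)"
  shows "\<exists>f. rat_poly_fun I f \<and> (\<forall>x. f x \<noteq> 0 \<longleftrightarrow> rows_independent (M x) N F)"
proof -
  obtain h where h: "bij_betw h {0..<card F} F"
    using ex_bij_betw_nat_finite[OF assms(1)] by blast
  let ?f = "\<lambda>x. det (mat (card F) (card F) (\<lambda>(a, b). \<Sum>c<N. M x (h a) c * M x (h b) c))"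
  have "rat_poly_fun I ?f"
    using bij_betwE[OF h]
    by (intro rat_poly_fun_det rat_poly_fun_sum rat_poly_fun.mult assms(2)) auto
  moreover have "\<forall>x. ?f x \<noteq> 0 \<longleftrightarrow> rows_independent (M x) N F"
    by (simp only: rows_independent_reindex[OF h] rows_independent_iff_gram_det simp_thms)
  ultimately show ?thesis by blast
qed

text \<open>Independence makes the transpose \<open>?M\<close> invertible, and \<open>V\<close> is
  the transpose of its right inverse.\<close>

lemma rows_independent_square_left_inverse:
  assumes "rows_independent M d {..<d}"
  shows "\<exists>V. \<forall>i<d. \<forall>c<d. (\<Sum>r<d. V i r * M r c) = (if i = c then 1 else 0)"
proof -
  let ?M = "mat d d (\<lambda>(c, r). M r c)"
  have M: "?M \<in> carrier_mat d d" by simp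
  have "det ?M \<noteq> 0"
  proof
    assume "det ?M = 0"
    then obtain v where v: "v \<in> carrier_vec d" "v \<noteq> 0\<^sub>v d" "?M *\<^sub>v v = 0\<^sub>v d"
      using det_0_iff_vec_prod_zero_field[OF M] by blast
    have "(\<Sum>r<d. v $ r * M r c) = 0" if "c < d" for c
    proof -
      have "(?M *\<^sub>v v) $ c = (\<Sum>r<d. v $ r * M r c)"
        using v(1) that by (simp add: scalar_prod_def mult_ac lessThan_atLeast0)
      then show ?thesis using v(3) that by simp
    qed
    then have "\<forall>r\<in>{..<d}. v $ r = 0"
      using assms unfolding rows_independent_def by (elim allE[of _ "\<lambda>r. v $ r"]) simp
    then show False using v(1,2) by auto
  qed
  from det_non_zero_imp_unit[OF M this, of "()"]
  obtain B where B: "B \<in> carrier_mat d d" "?M * B = 1\<^sub>m d"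
    unfolding Units_def ring_mat_def by auto
  have "(\<Sum>r<d. B $$ (r, i) * M r c) = (if i = c then 1 else 0)" if "i < d" "c < d" for i c
  proof -
    have "(?M * B) $$ (c, i) = (\<Sum>r<d. B $$ (r, i) * M r c)"
      using B(1) that by (simp add: scalar_prod_def mult_ac lessThan_atLeast0)
    then show ?thesis using B(2) that by auto
  qed
  then show ?thesis by (intro exI[of _ "\<lambda>i r. B $$ (r, i)"]) blast
qed

section \<open>Matchings and matroids\<close>

text \<open>Rado's argument by induction on the total size. If some set has two elements, one of
  them can be deleted without destroying the existence of a matching; if all sets are singletons,
  the condition on pairs makes them distinct.\<close>

lemma hall_marriage:
  fixes S :: "'a \<Rightarrow> 'b set"
  assumes "finite R" and "\<And>r. r \<in> R \<Longrightarrow> finite (S r)"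
    and "\<And>J. J \<subseteq> R \<Longrightarrow> card J \<le> card (\<Union>r\<in>J. S r)"
  shows "\<exists>\<phi>. inj_on \<phi> R \<and> (\<forall>r\<in>R. \<phi> r \<in> S r)"
  using assms(2,3)
proof (induction "\<Sum>r\<in>R. card (S r)" arbitrary: S rule: less_induct)
  case less
  note fin = less.prems(1) and hall = less.prems(2)
  have fJ: "finite (\<Union>r\<in>J. S r)" if "J \<subseteq> R" for J
    using that assms(1) fin finite_subset by (intro finite_UN_I) blast+
  show ?case
  proof (cases "\<exists>r\<in>R. 1 < card (S r)")
    case False
    have "card (S r) = 1" if "r \<in> R" for r
      using False hall[of "{r}"] that by fastforce
    then have "\<forall>r\<in>R. \<exists>x. S r = {x}" by (meson card_1_singletonE)
    then obtain \<phi> where \<phi>: "\<And>r. r \<in> R \<Longrightarrow> S r = {\<phi> r}" by metis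
    have "inj_on \<phi> R"
    proof (rule inj_onI, rule ccontr)
      fix a b assume "a \<in> R" "b \<in> R" "\<phi> a = \<phi> b" "a \<noteq> b"
      then show False using hall[of "{a, b}"] \<phi> by simp
    qed
    then show ?thesis using \<phi> by blast
  next
    case True
    then obtain r where r: "r \<in> R" "1 < card (S r)" by blast
    then obtain x y where xy: "x \<in> S r" "y \<in> S r" "x \<noteq> y"
      by (metis One_nat_def card_le_Suc0_iff_eq fin[OF r(1)] not_le)
    \<comment> \<open>If Hall's condition survived the deletion of \<open>z\<close> from
      \<open>S r\<close>, the induction hypothesis would give a matching. A violating index set must
      contain \<open>r\<close>; \<open>J\<close> is that set without \<open>r\<close>.\<close>
    have step: "\<exists>J. J \<subseteq> R - {r} \<and> card ((\<Union>i\<in>J. S i) \<union> (S r - {z})) \<le> card J"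
      if z: "z \<in> S r" and no: "\<nexists>\<phi>. inj_on \<phi> R \<and> (\<forall>r\<in>R. \<phi> r \<in> S r)" for z
    proof (rule ccontr)
      assume neg: "\<not> ?thesis"
      let ?S = "S(r := S r - {z})"
      have lt: "(\<Sum>i\<in>R. card (?S i)) < (\<Sum>i\<in>R. card (S i))"
        using assms(1) r(1) z fin[OF r(1)]
        by (intro sum_strict_mono_ex1) (auto simp del: card_Diff_singleton card_Diff_insert
            intro: card_Diff1_le intro!: bexI[of _ r] card_Diff1_less)
      have h: "card J \<le> card (\<Union>i\<in>J. ?S i)" if J: "J \<subseteq> R" for J
      proof (cases "r \<in> J")
        case False
        then have "(\<Union>i\<in>J. ?S i) = (\<Union>i\<in>J. S i)" by auto
        then show ?thesis using hall[OF J] by simp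
      next
        case True
        have "(\<Union>i\<in>J. ?S i) = (\<Union>i\<in>J - {r}. S i) \<union> (S r - {z})"
          using True by auto
        moreover have "card (J - {r}) < card ((\<Union>i\<in>J - {r}. S i) \<union> (S r - {z}))"
          using neg J by (meson Diff_mono not_le subset_refl)
        moreover have "card J = Suc (card (J - {r}))"
          using True J assms(1) by (metis card.remove finite_subset)
        ultimately show ?thesis by simp
      qed
      have "finite (?S i)" if "i \<in> R" for i using fin[OF that] fin[OF r(1)] by simp
      then obtain \<phi> where \<phi>: "inj_on \<phi> R" "\<forall>i\<in>R. \<phi> i \<in> ?S i"
        using less.hyps[OF lt _ h] by blast
      have "\<forall>i\<in>R. \<phi> i \<in> S i"
        using \<phi>(2) by (metis Diff_iff fun_upd_apply)
      then show False using \<phi>(1) no by blast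
    qed
    show ?thesis
    proof (rule ccontr)
      assume no: "\<not> ?thesis"
      obtain J1 where J1: "J1 \<subseteq> R - {r}" "card ((\<Union>i\<in>J1. S i) \<union> (S r - {x})) \<le> card J1"
        using step[OF xy(1) no] by blast
      obtain J2 where J2: "J2 \<subseteq> R - {r}" "card ((\<Union>i\<in>J2. S i) \<union> (S r - {y})) \<le> card J2"
        using step[OF xy(2) no] by blast
      let ?A = "(\<Union>i\<in>J1. S i) \<union> (S r - {x})" and ?B = "(\<Union>i\<in>J2. S i) \<union> (S r - {y})"
      have fA: "finite ?A" "finite ?B" using fJ[of J1] fJ[of J2] J1 J2 fin[OF r(1)] by auto
      have fj: "finite J1" "finite J2" using J1 J2 assms(1) finite_subset by blast+
      \<comment> \<open>Submodularity: as \<open>x\<close> and \<open>y\<close> differ,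
        \<open>?A\<close> and \<open>?B\<close> together cover \<open>S r\<close>. Adding the Hall
        inequalities for the union with \<open>r\<close> and for the intersection gives |J1| + |J2|
        + 1 <= |?A| + |?B|, against the choice of \<open>J1\<close> and \<open>J2\<close>.\<close>
      have "card (insert r (J1 \<union> J2)) \<le> card (\<Union>i\<in>insert r (J1 \<union> J2). S i)"
        using J1 J2 r(1) by (intro hall) auto
      also have "\<dots> = card (?A \<union> ?B)" using xy(3) by (intro arg_cong[where f = card]) auto
      finally have 1: "Suc (card (J1 \<union> J2)) \<le> card (?A \<union> ?B)"
        using J1(1) J2(1) fj by (subst (asm) card_insert_disjoint) auto
      have "card (J1 \<inter> J2) \<le> card (\<Union>i\<in>J1 \<inter> J2. S i)"
        using J1 by (intro hall) auto
      also have "\<dots> \<le> card (?A \<inter> ?B)" using fA by (intro card_mono) auto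
      finally have 2: "card (J1 \<inter> J2) \<le> card (?A \<inter> ?B)" .
      show False
        using 1 2 card_Un_Int[OF fA] card_Un_Int[OF fj] J1(2) J2(2) by linarith
    qed
  qed
qed

section \<open>The matroid of the rows of a matrix\<close>

lemma homogeneous_system_nontrivial_solution:
  fixes a :: "'y \<Rightarrow> 'x \<Rightarrow> real"
  assumes "finite X" and "finite Y" and "card X < card Y"
  shows "\<exists>s. (\<exists>y\<in>Y. s y \<noteq> 0) \<and> (\<forall>x\<in>X. (\<Sum>y\<in>Y. s y * a y x) = 0)"
  using assms
proof (induction X arbitrary: Y a)
  case empty
  then obtain y where "y \<in> Y" by fastforce
  then show ?case by (intro exI[of _ "\<lambda>_. 1"]) auto
next
  case (insert x X)
  show ?case
  proof (cases "\<forall>y\<in>Y. a y x = 0")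
    case True
    obtain s where "\<exists>y\<in>Y. s y \<noteq> 0" "\<forall>x\<in>X. (\<Sum>y\<in>Y. s y * a y x) = 0"
      using insert by (metis Suc_lessD card_insert_disjoint)
    then show ?thesis using True by (intro exI[of _ s]) auto
  next
    case False
    then obtain z where z: "z \<in> Y" "a z x \<noteq> 0" by blast
    let ?Y = "Y - {z}"
    \<comment> \<open>Gaussian elimination: \<open>?b\<close> are the coefficients once equation
      \<open>x\<close> has been used to eliminate the unknown \<open>z\<close>. The value
      \<open>c\<close> below recovers \<open>z\<close> from the other unknowns.\<close>
    let ?b = "\<lambda>y w. a y w - a y x / a z x * a z w"
    have "finite ?Y" "card X < card ?Y"
      using insert z(1) by auto
    from insert.IH[OF this, of ?b] obtain s where
      s: "\<exists>y\<in>?Y. s y \<noteq> 0" "\<forall>w\<in>X. (\<Sum>y\<in>?Y. s y * ?b y w) = 0" by blast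
    define c where "c = - (\<Sum>y\<in>?Y. s y * (a y x / a z x))"
    have sum: "(\<Sum>y\<in>Y. (s(z := c)) y * a y w) = (\<Sum>y\<in>?Y. s y * ?b y w)" for w
    proof -
      have "(\<Sum>y\<in>Y. (s(z := c)) y * a y w) = c * a z w + (\<Sum>y\<in>?Y. s y * a y w)"
        using z(1) insert.prems(1) by (subst sum.remove[of _ z]) (auto intro!: sum.cong)
      also have "\<dots> = (\<Sum>y\<in>?Y. s y * ?b y w)"
        unfolding c_def by (simp add: sum_distrib_right sum_distrib_left sum_subtractf right_diff_distrib mult_ac)
      finally show ?thesis .
    qed
    have "(\<Sum>y\<in>Y. (s(z := c)) y * a y x) = 0"
      unfolding sum using z(2) by simp
    then show ?thesis using s sum by (intro exI[of _ "s(z := c)"]) auto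
  qed
qed

lemma rows_independent_subset:
  assumes "rows_independent M N X" and "Y \<subseteq> X" and "finite X"
  shows "rows_independent M N Y"
  unfolding rows_independent_def
proof (intro allI impI)
  fix s assume s: "\<forall>c<N. (\<Sum>e\<in>Y. s e * M e c) = 0"
  let ?s = "\<lambda>e. if e \<in> Y then s e else 0"
  have "(\<Sum>e\<in>X. ?s e * M e c) = (\<Sum>e\<in>Y. s e * M e c)" for c
    using assms by (intro sum.mono_neutral_cong_right) auto
  then have "\<forall>e\<in>X. ?s e = 0"
    using assms(1) s unfolding rows_independent_def by (elim allE[of _ ?s]) simp
  then show "\<forall>e\<in>Y. s e = 0" using assms(2) by (metis subsetD)
qed

text \<open>Steinitz exchange: if no row of \<open>Y\<close> can be added, all of them are
  combinations of the fewer rows in \<open>X\<close>. A nontrivial \<open>s\<close> annihilating the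
  coefficients is then a relation on \<open>Y\<close>.\<close>

lemma rows_independent_augment:
  assumes "finite X" and "finite Y" and "card X < card Y"
    and "rows_independent M N X" and "rows_independent M N Y"
  shows "\<exists>e\<in>Y - X. rows_independent M N (insert e X)"
proof (rule ccontr)
  assume neg: "\<not> ?thesis"
  have "\<exists>a. \<forall>c<N. M y c = (\<Sum>x\<in>X. a x * M x c)" if y: "y \<in> Y" for y
  proof (cases "y \<in> X")
    case True
    then show ?thesis
      using assms(1) by (intro exI[of _ "\<lambda>x. if x = y then 1 else 0"]) 
        (simp add: if_distrib[of "\<lambda>t. t * _"] cong: if_cong)
  next
    case False
    then have "\<not> rows_independent M N (insert y X)" using neg y by blast
    then obtain s where s: "\<forall>c<N. (\<Sum>e\<in>insert y X. s e * M e c) = 0" "\<exists>e\<in>insert y X. s e \<noteq> 0"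
      unfolding rows_independent_def by blast
    have eq: "s y * M y c + (\<Sum>e\<in>X. s e * M e c) = 0" if "c < N" for c
      using s(1) that False assms(1) by simp
    have "s y \<noteq> 0"
    proof
      assume "s y = 0"
      then have "\<forall>e\<in>X. s e = 0" using eq assms(4) unfolding rows_independent_def by simp
      then show False using s(2) \<open>s y = 0\<close> by simp
    qed
    then have "M y c = (\<Sum>x\<in>X. (- s x / s y) * M x c)" if "c < N" for c
      using eq[OF that] by (simp add: sum_negf sum_divide_distrib[symmetric] field_simps)
    then show ?thesis by (intro exI[of _ "\<lambda>x. - s x / s y"]) blast
  qed
  then obtain a where a: "\<And>y c. y \<in> Y \<Longrightarrow> c < N \<Longrightarrow> M y c = (\<Sum>x\<in>X. a y x * M x c)" by metis
  obtain s where s: "\<exists>y\<in>Y. s y \<noteq> 0" "\<forall>x\<in>X. (\<Sum>y\<in>Y. s y * a y x) = 0"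
    using homogeneous_system_nontrivial_solution[OF assms(1-3)] by blast
  have "(\<Sum>y\<in>Y. s y * M y c) = 0" if "c < N" for c
  proof -
    have "(\<Sum>y\<in>Y. s y * M y c) = (\<Sum>y\<in>Y. \<Sum>x\<in>X. s y * a y x * M x c)"
      using a that by (intro sum.cong) (auto simp: sum_distrib_left mult_ac)
    also have "\<dots> = (\<Sum>x\<in>X. (\<Sum>y\<in>Y. s y * a y x) * M x c)"
      by (subst sum.swap) (simp add: sum_distrib_right)
    also have "\<dots> = 0" using s(2) by simp
    finally show ?thesis .
  qed
  then show False using assms(5) s(1) unfolding rows_independent_def by blast
qed

lemma matroid_on_rows_independent:
  assumes "finite E"
  shows "matroid_on E {F. F \<subseteq> E \<and> rows_independent M N F}"
  unfolding matroid_on_def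
proof (intro conjI ballI allI impI)
  show "{} \<in> {F. F \<subseteq> E \<and> rows_independent M N F}" by (simp add: rows_independent_def)
next
  fix X Y assume "X \<in> {F. F \<subseteq> E \<and> rows_independent M N F}" "Y \<subseteq> X"
  then show "Y \<in> {F. F \<subseteq> E \<and> rows_independent M N F}"
    using assms rows_independent_subset finite_subset by blast
next
  fix X Y assume "X \<in> {F. F \<subseteq> E \<and> rows_independent M N F}"
    "Y \<in> {F. F \<subseteq> E \<and> rows_independent M N F}" "card X < card Y"
  then show "\<exists>e\<in>Y - X. insert e X \<in> {F. F \<subseteq> E \<and> rows_independent M N F}"
    using rows_independent_augment[of X Y M N] assms finite_subset by blast
qed (use assms in auto)

section \<open>The rank bound in rooted matroids\<close>

lemma matroid_on_extend:
  assumes "matroid_on E \<I>" and "X \<in> \<I>" and "Y \<in> \<I>" and "card X \<le> card Y"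
  shows "\<exists>B\<in>\<I>. X \<subseteq> B \<and> B \<subseteq> X \<union> Y \<and> card B = card Y"
  using assms(2-)
proof (induction "card Y - card X" arbitrary: X)
  case 0
  then show ?case by auto
next
  case (Suc t)
  then have "card X < card Y" by simp
  then obtain e where e: "e \<in> Y - X" "insert e X \<in> \<I>"
    using assms(1) Suc.prems unfolding matroid_on_def by meson
  have "finite X" using assms(1) Suc.prems unfolding matroid_on_def by (meson finite_subset)
  then have c: "card (insert e X) = Suc (card X)" using e(1) by simp
  have "\<exists>B\<in>\<I>. insert e X \<subseteq> B \<and> B \<subseteq> insert e X \<union> Y \<and> card B = card Y"
    using Suc.hyps(2) Suc.prems(2) \<open>card X < card Y\<close> e(2) c by (intro Suc.hyps(1)) auto
  then show ?case using e(1) by blast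
qed

lemma rooted_K_matroid_circuit:
  assumes "rooted_K_matroid s t m n \<I>"
    and "X \<subseteq> {..<m}" and "card X = s" and "Y \<subseteq> {..<n}" and "card Y = t"
  shows "circuit_of (K_edges m n) \<I> (X \<times> Y)"
proof -
  have fin: "finite X" "finite Y" using assms finite_subset by blast+
  obtain f g where f: "bij_betw f {..<s} X" and g: "bij_betw g {..<t} Y"
    using ex_bij_betw_nat_finite[OF fin(1)] ex_bij_betw_nat_finite[OF fin(2)] assms(3,5)
    by (metis lessThan_atLeast0)
  have "X \<times> Y = map_prod f g ` K_edges s t"
    using f g unfolding K_edges_def bij_betw_def by (metis map_prod_surj_on)
  then have "rooted_copy_edges {..<s} {..<t} (K_edges s t) m n (X \<times> Y)"
    unfolding rooted_copy_edges_def using f g assms(2,4) unfolding bij_betw_def by blast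
  then show ?thesis
    using assms(1) unfolding rooted_K_matroid_def rooted_matroid_def by blast
qed

text \<open>That \<open>?B\<close> spans the rectangle is expressed by augmentation alone: a largest
  independent subset \<open>B1\<close> of \<open>?B\<close> would be augmented from the larger set
  \<open>J\<close> by an edge \<open>e\<close> outside \<open>?B\<close>, and exchange along a
  circuit through \<open>e\<close> then yields a larger independent subset of
  \<open>?B\<close>.\<close>

lemma rooted_K_matroid_rank_bound:
  assumes M: "rooted_K_matroid (k + 1) 2 m n \<I>"
    and X: "X \<subseteq> {..<m}" "k \<le> card X" and Y: "Y \<subseteq> {..<n}" "Y \<noteq> {}"
    and J: "J \<in> \<I>" "J \<subseteq> X \<times> Y"
  shows "card J + k \<le> card X + k * card Y"
proof (rule ccontr)
  assume neg: "\<not> ?thesis"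
  have mat: "matroid_on (K_edges m n) \<I>"
    using M unfolding rooted_K_matroid_def rooted_matroid_def by blast
  have fin: "finite X" "finite Y" using X Y finite_subset by blast+
  obtain X0 where X0: "X0 \<subseteq> X" "card X0 = k" "finite X0"
    using obtain_subset_with_card_n[OF X(2)] by blast
  obtain y0 where y0: "y0 \<in> Y" using Y by blast
  let ?B = "X0 \<times> Y \<union> (X - X0) \<times> {y0}"
  have finB: "finite ?B" using fin X0 by auto
  have "card ?B \<le> k * card Y + (card X - k)"
    using card_Un_le[of "X0 \<times> Y" "(X - X0) \<times> {y0}"] X0 fin
    by (simp add: card_cartesian_product card_Diff_subset)
  then have cB: "card ?B < card J" using neg X(2) by linarith
  let ?I = "{S. S \<in> \<I> \<and> S \<subseteq> ?B}"
  have empty: "{} \<in> ?I" using mat unfolding matroid_on_def by simp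
  have "\<forall>S. S \<in> ?I \<longrightarrow> card S < Suc (card ?B)"
    using card_mono[OF finB] by (simp add: less_Suc_eq_le)
  from ex_has_greatest_nat[where P = "\<lambda>S. S \<in> ?I" and f = card, OF empty this]
  obtain B1 where B1: "B1 \<in> ?I" and max: "\<And>S. S \<in> ?I \<Longrightarrow> card S \<le> card B1"
    by blast
  have "card B1 \<le> card ?B" using B1 by (intro card_mono[OF finB]) blast
  then have less: "card B1 < card J" using cB by linarith
  have "B1 \<in> \<I>" using B1 by blast
  then obtain e where e: "e \<in> J - B1" "insert e B1 \<in> \<I>"
    using mat J(1) less unfolding matroid_on_def by meson
  have fB1: "finite B1" using B1 finB finite_subset by blast
  have ce: "card (insert e B1) = Suc (card B1)" using e fB1 by simp
  have eB: "e \<notin> ?B"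
  proof
    assume "e \<in> ?B"
    then have "insert e B1 \<in> ?I" using B1 e(2) by simp
    then show False using max ce by fastforce
  qed
  obtain x y where xy: "e = (x, y)" by (cases e)
  have x: "x \<in> X" "x \<notin> X0" and y: "y \<in> Y" "y \<noteq> y0"
    using eB e J(2) unfolding xy by auto
  let ?C = "insert x X0 \<times> {y0, y}"
  have circ: "circuit_of (K_edges m n) \<I> ?C"
    using X0 x y X Y y0 by (intro rooted_K_matroid_circuit[OF M]) auto
  have CB: "?C - {e} \<subseteq> ?B" using x y y0 X0 unfolding xy by auto
  have CI: "?C - {e} \<in> \<I>"
  proof -
    have "?C - {e} \<subset> ?C" unfolding xy by auto
    then show ?thesis using circ unfolding circuit_of_def by blast
  qed
  then have "card (?C - {e}) \<le> card B1" using max CB by simp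
  \<comment> \<open>Since \<open>?C\<close> is dependent, the extension \<open>B2\<close> of
    \<open>?C - {e}\<close> cannot contain \<open>e\<close>. It therefore stays inside
    \<open>?B\<close> and exceeds \<open>B1\<close> by one element.\<close>
  then obtain B2 where B2: "B2 \<in> \<I>" "?C - {e} \<subseteq> B2" "B2 \<subseteq> (?C - {e}) \<union> insert e B1"
      "card B2 = Suc (card B1)"
    using matroid_on_extend[OF mat CI e(2)] ce by auto
  have "e \<notin> B2"
  proof
    assume "e \<in> B2"
    then have "?C \<subseteq> B2" using B2(2) by auto
    then have "?C \<in> \<I>" using mat B2(1) unfolding matroid_on_def by blast
    then show False using circ unfolding circuit_of_def by blast
  qed
  then have "B2 \<in> ?I" using B2(1,3) CB B1 by blast
  then show False using max B2(4) by fastforce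
qed

section \<open>Sparse bipartite graphs and generic rigidity\<close>

text \<open>The special point for the minors below: substituting the 0-1 matrix of a matching shows
  that a determinant in indeterminates is not identically zero.\<close>

lemma rows_independent_matching:
  assumes "finite R" and "inj_on \<phi> R" and "\<And>r. r \<in> R \<Longrightarrow> \<phi> r < N"
    and "\<And>r c. r \<in> R \<Longrightarrow> c < N \<Longrightarrow> M r c = (if c = \<phi> r then 1 else 0)"
  shows "rows_independent M N R"
  unfolding rows_independent_def
proof (intro allI impI ballI)
  fix s r assume s: "\<forall>c<N. (\<Sum>e\<in>R. s e * M e c) = 0" and r: "r \<in> R"
  have "(\<Sum>e\<in>R. s e * M e (\<phi> r)) = (\<Sum>e\<in>R. if e = r then s e else 0)"
    using assms r by (intro sum.cong) (auto dest: inj_onD)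
  also have "\<dots> = s r" using assms(1) r by simp
  finally show "s r = 0" using s assms(3)[OF r] by simp
qed

lemma interval_blocks:
  fixes t :: "nat \<Rightarrow> nat"
  shows "\<exists>own::nat \<Rightarrow> nat. (\<forall>r<\<Sum>j<n. t j. own r < n) \<and> (\<forall>r\<ge>\<Sum>j<n. t j. own r = n) \<and>
           (\<forall>j<n. card {r. own r = j} = t j)"
proof (induction n)
  case 0
  show ?case by (intro exI[of _ "\<lambda>_. 0"]) simp
next
  case (Suc n)
  let ?S = "\<Sum>j<n. t j"
  obtain own where own: "\<And>r. r < ?S \<Longrightarrow> own r < n" "\<And>r. r \<ge> ?S \<Longrightarrow> own r = n"
    "\<And>j. j < n \<Longrightarrow> card {r. own r = j} = t j"
    using Suc by blast
  \<comment> \<open>The old default \<open>n\<close> becomes the name of the new block on its first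
    \<open>t n\<close> positions; later positions move to the new default
    \<open>Suc n\<close>.\<close>
  define own' where "own' r = (if r < ?S then own r else if r < ?S + t n then n else Suc n)" for r
  have 1: "\<forall>r<?S + t n. own' r < Suc n" using own(1) by (auto simp: own'_def less_SucI)
  have own'_n: "own' r = n \<longleftrightarrow> ?S \<le> r \<and> r < ?S + t n" for r
    using own(1)[of r] by (auto simp: own'_def)
  have "{r. own' r = n} = {?S..<?S + t n}" unfolding own'_n by auto
  then have 2: "card {r. own' r = n} = t n" by simp
  have 3: "card {r. own' r = j} = t j" if "j < n" for j
  proof -
    have "own' r = j \<longleftrightarrow> own r = j" for r
      using own(2)[of r] that by (auto simp: own'_def)
    then show ?thesis using own(3)[OF that] by simp
  qed
  have 4: "\<forall>r\<ge>?S + t n. own' r = Suc n" by (auto simp: own'_def)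
  have 5: "\<forall>j<Suc n. card {r. own' r = j} = t j" using 2 3 by (auto simp: less_Suc_eq)
  show ?case unfolding sum.lessThan_Suc using 1 4 5 by blast
qed

text \<open>
  The last \<open>k\<close> rows of \<open>G\<close> only complete the first \<open>m - k\<close> rows to a basis. The block of row
  \<open>r\<close> is \<open>own r\<close>, and \<open>own r = n\<close> means that the support of row \<open>r\<close> is unrestricted. The Hall
  condition for the matchings of all rows but those of block \<open>j\<close> into the complement of \<open>A j\<close> is the
  count for index sets containing \<open>j\<close>.
\<close>

lemma exists_matrix_with_supports:
  fixes A :: "nat \<Rightarrow> nat set"
  assumes km: "k \<le> m" and A: "\<And>j. j < n \<Longrightarrow> A j \<subseteq> {..<m}"
    and sparse: "\<And>Y. Y \<subseteq> {..<n} \<Longrightarrow> Y \<noteq> {} \<Longrightarrow> (\<And>j. j \<in> Y \<Longrightarrow> k \<le> card (A j)) \<Longrightarrow>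
       (\<Sum>j\<in>Y. card (A j)) + k \<le> card (\<Union>j\<in>Y. A j) + k * card Y"
  shows "\<exists>own (G :: nat \<Rightarrow> nat \<Rightarrow> real).
    (\<forall>r c. own r < n \<longrightarrow> c \<notin> A (own r) \<longrightarrow> G r c = 0) \<and>
    rows_independent G m {..<m} \<and>
    (\<forall>j<n. rows_independent (\<lambda>r c. if c \<in> A j then 0 else G r c) m {r. r < m - k \<and> own r \<noteq> j})"
proof -
  \<comment> \<open>The expected dimension of the vectors supported on \<open>A j\<close> in a space
    of codimension \<open>k\<close>. Truncated subtraction gives 0 when \<open>A j\<close> is
    smaller than \<open>k\<close>.\<close>
  define t where "t j = card (A j) - k" for j
  have finA: "finite (A j)" if "j < n" for j using A[OF that] finite_subset by blast
  have key: "(\<Sum>j\<in>Y. t j) + k \<le> card (\<Union>j\<in>Y. A j)"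
    if Y: "Y \<subseteq> {..<n}" "Y \<noteq> {}" "\<And>j. j \<in> Y \<Longrightarrow> k \<le> card (A j)" for Y
  proof -
    have "(\<Sum>j\<in>Y. card (A j)) = (\<Sum>j\<in>Y. t j + k)"
      using Y(3) by (intro sum.cong) (auto simp: t_def)
    also have "\<dots> = (\<Sum>j\<in>Y. t j) + k * card Y" by (simp add: sum.distrib)
    finally show ?thesis using sparse[OF Y] by simp
  qed
  have total: "(\<Sum>j<n. t j) \<le> m - k"
  proof -
    let ?Y = "{j. j < n \<and> k \<le> card (A j)}"
    have eq: "(\<Sum>j<n. t j) = (\<Sum>j\<in>?Y. t j)"
      by (intro sum.mono_neutral_right) (auto simp: t_def)
    show ?thesis
    proof (cases "?Y = {}")
      case True
      then show ?thesis unfolding eq True by simp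
    next
      case False
      have "(\<Sum>j\<in>?Y. t j) + k \<le> card (\<Union>j\<in>?Y. A j)"
        by (rule key) (use False in auto)
      also have "\<dots> \<le> card {..<m}" using A by (intro card_mono) auto
      finally show ?thesis unfolding eq by simp
    qed
  qed
  obtain own where own: "\<And>r. r < (\<Sum>j<n. t j) \<Longrightarrow> own r < n"
      "\<And>r. r \<ge> (\<Sum>j<n. t j) \<Longrightarrow> own r = n" "\<And>j. j < n \<Longrightarrow> card {r. own r = j} = t j"
    using interval_blocks[where t = t and n = n] by blast
  have block: "{r. own r = j} \<subseteq> {..<m - k}" if "j < n" for j
  proof
    fix r assume "r \<in> {r. own r = j}"
    then have "r < (\<Sum>j<n. t j)" using own(2)[of r] that by fastforce
    then show "r \<in> {..<m - k}" using total by simp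
  qed
  have finblock: "finite {r. own r = j}" if "j < n" for j
    using block[OF that] finite_subset by blast
  have own_le: "own r \<le> n" for r using own(1,2)[of r] by (cases "r < (\<Sum>j<n. t j)") auto
  have card_J: "card J \<le> (\<Sum>j\<in>own ` J. t j)" if "\<And>r. r \<in> J \<Longrightarrow> own r < n" "finite J" for J
  proof -
    have "card J \<le> card (\<Union>j\<in>own ` J. {r. own r = j})"
      using that finblock by (intro card_mono finite_UN_I) auto
    also have "\<dots> \<le> (\<Sum>j\<in>own ` J. card {r. own r = j})"
      using that by (intro card_UN_le) auto
    also have "\<dots> = (\<Sum>j\<in>own ` J. t j)"
      using that own(3) by (intro sum.cong) auto
    finally show ?thesis .
  qed
  have big: "k \<le> card (A (own r))" if "own r < n" for r
  proof -
    have "0 < card {r'. own r' = own r}"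
      using finblock[OF that] by (subst card_gt_0_iff) auto
    then show ?thesis using own(3)[OF that] by (simp add: t_def)
  qed
  \<comment> \<open>\<open>B r\<close> is the permitted support of row \<open>r\<close>. An index
    \<open>j < n\<close> stands for the rows outside block \<open>j\<close> with the columns in
    \<open>A j\<close> masked; the index \<open>n\<close> stands for the full square matrix, so that
    one matching argument covers both.\<close>
  define B where "B r = (if own r < n then A (own r) else {..<m})" for r
  define mask where "mask j = (if j < n then A j else {})" for j
  define R where "R j = (if j < n then {r. r < m - k \<and> own r \<noteq> j} else {..<m})" for j
  have finR: "finite (R j)" for j unfolding R_def by auto
  have B: "B r \<subseteq> {..<m}" for r unfolding B_def using A by auto
  have "\<exists>\<phi>. inj_on \<phi> (R j) \<and> (\<forall>r\<in>R j. \<phi> r \<in> B r - mask j)" for j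
  proof (rule hall_marriage)
    fix J assume J: "J \<subseteq> R j"
    have finJ: "finite J" using J finR finite_subset by blast
    let ?U = "\<Union>r\<in>J. B r - mask j"
    have finU: "finite ?U" using B finJ by (meson finite_Diff finite_UN_I finite_lessThan finite_subset)
    consider "J = {}" | r where "r \<in> J" "own r = n" | "J \<noteq> {}" "\<And>r. r \<in> J \<Longrightarrow> own r < n"
      using own_le by (metis all_not_in_conv le_neq_implies_less)
    then show "card J \<le> card ?U"
    proof cases
      case 1
      then show ?thesis by simp
    next
      \<comment> \<open>A row of unrestricted support already reaches every unmasked column, so it
        suffices that the rows in \<open>R j\<close> do not outnumber these columns.\<close>
      case (2 r)
      have "{..<m} - mask j \<subseteq> ?U" using 2 unfolding B_def by auto
      then have U: "card ({..<m} - mask j) \<le> card ?U" using finU by (rule card_mono[rotated])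
      show ?thesis
      proof (cases "j < n")
        case True
        have "R j = {..<m - k} - {r. own r = j}" using True unfolding R_def by auto
        then have "card (R j) = m - k - t j"
          using card_Diff_subset[OF finblock[OF True] block[OF True]] own(3)[OF True] by simp
        moreover have "card ({..<m} - mask j) = m - card (A j)"
          using True card_Diff_subset[OF finA[OF True] A[OF True]] unfolding mask_def by simp
        moreover have "card (A j) \<le> m"
          using card_mono[OF _ A[OF True]] by simp
        ultimately have "card (R j) \<le> card ({..<m} - mask j)"
          unfolding t_def by simp
        then show ?thesis using card_mono[OF finR J] U by linarith
      next
        case False
        then have "card (R j) = card ({..<m} - mask j)" unfolding R_def mask_def by simp
        then show ?thesis using card_mono[OF finR J] U by linarith
      qed
    next
      case 3
      let ?Y = "own ` J"
      have Y: "?Y \<subseteq> {..<n}" "?Y \<noteq> {}" "\<And>i. i \<in> ?Y \<Longrightarrow> k \<le> card (A i)"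
        using 3 big by auto
      let ?V = "\<Union>i\<in>?Y. A i"
      have finV: "finite ?V" using Y finA finJ by auto
      have U: "?U = ?V - mask j" using 3 unfolding B_def by auto
      have cJ: "card J \<le> (\<Sum>i\<in>?Y. t i)" using 3 finJ by (intro card_J) auto
      have keyY: "(\<Sum>i\<in>?Y. t i) + k \<le> card ?V" using Y by (intro key) auto
      show ?thesis
      proof (cases "j < n")
        case False
        then show ?thesis using U cJ keyY unfolding mask_def by simp
      next
        case True
        have mask: "mask j = A j" using True unfolding mask_def by simp
        have union: "card (?V \<union> A j) = card ?U + card (A j)"
          unfolding U unfolding mask Un_Diff_cancel2[symmetric, of ?V]
          using finV finA[OF True] by (intro card_Un_disjoint) auto
        show ?thesis
        proof (cases "k \<le> card (A j)")
          \<comment> \<open>Block \<open>j\<close> is not among those of \<open>J\<close>. Adding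
            \<open>j\<close> to the count contributes \<open>t j\<close>, and \<open>t j + k\<close>
            is exactly the number of masked columns.\<close>
          case big_j: True
          have "j \<notin> ?Y" using J True unfolding R_def by auto
          then have "t j + (\<Sum>i\<in>?Y. t i) = (\<Sum>i\<in>insert j ?Y. t i)" using finJ by simp
          moreover have "(\<Sum>i\<in>insert j ?Y. t i) + k \<le> card (\<Union>i\<in>insert j ?Y. A i)"
            using Y True big_j by (intro key) auto
          moreover have "(\<Union>i\<in>insert j ?Y. A i) = ?V \<union> A j" by auto
          ultimately show ?thesis using cJ union big_j unfolding t_def[of j] by simp
        next
          \<comment> \<open>Fewer than \<open>k\<close> columns are masked, which the summand
            \<open>k\<close> in the count absorbs.\<close>
          case False
          have "card ?V \<le> card (?V \<union> A j)" using finV finA[OF True] by (intro card_mono) auto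
          then show ?thesis using cJ union keyY False by linarith
        qed
      qed
    qed
  next
    show "finite (R j)" by (rule finR)
    show "finite (B r - mask j)" for r using B finite_subset by blast
  qed
  then obtain \<phi> where \<phi>: "\<And>j. inj_on (\<phi> j) (R j)" "\<And>j r. r \<in> R j \<Longrightarrow> \<phi> j r \<in> B r - mask j"
    by metis
  define M :: "nat \<Rightarrow> (nat \<times> nat \<Rightarrow> real) \<Rightarrow> nat \<Rightarrow> nat \<Rightarrow> real"
    where "M j x r c = (if c \<in> mask j then 0 else if c \<in> B r then x (r, c) else 0)" for j x r c
  have "\<exists>f. rat_poly_fun UNIV f \<and> (\<forall>x. f x \<noteq> 0 \<longleftrightarrow> rows_independent (M j x) m (R j))" for j
    unfolding M_def
    by (intro rows_independent_rat_poly_fun finR rat_poly_fun_if rat_poly_fun_0 rat_poly_fun.var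
        UNIV_I)
  then obtain f where f: "\<And>j. rat_poly_fun UNIV (f j)"
      "\<And>j x. f j x \<noteq> 0 \<longleftrightarrow> rows_independent (M j x) m (R j)"
    by metis
  have "\<exists>x. f j x \<noteq> 0" for j
  proof -
    have "rows_independent (M j (\<lambda>(r, c). if c = \<phi> j r then 1 else 0)) m (R j)"
      using \<phi>(2) B by (intro rows_independent_matching[OF finR \<phi>(1)]) (auto simp: M_def)
    then show ?thesis using f(2) by blast
  qed
  \<comment> \<open>A single choice of entries serves all finitely many independence conditions
    simultaneously.\<close>
  then have "\<exists>x. \<forall>h\<in>f ` {..n}. h x \<noteq> 0"
    using f(1) by (intro rat_poly_fun_common_nonzero[where I = UNIV]) auto
  then obtain x where x: "\<And>j. j \<le> n \<Longrightarrow> rows_independent (M j x) m (R j)"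
    using f(2) by auto
  let ?G = "M n x"
  have "\<forall>r c. own r < n \<longrightarrow> c \<notin> A (own r) \<longrightarrow> ?G r c = 0"
    by (simp add: M_def B_def)
  moreover have "rows_independent ?G m {..<m}" using x[of n] by (simp add: R_def)
  moreover have "rows_independent (\<lambda>r c. if c \<in> A j then 0 else ?G r c) m {r. r < m - k \<and> own r \<noteq> j}"
    if "j < n" for j
  proof -
    have "(\<lambda>r c. if c \<in> A j then 0 else ?G r c) = M j x"
      using that by (intro ext) (simp add: M_def mask_def)
    then show ?thesis using x[of j] that by (simp add: R_def)
  qed
  ultimately show ?thesis by (intro exI[of _ own] exI[of _ ?G]) blast
qed

text \<open>Take for \<open>p\<close> the last \<open>k\<close> columns of the inverse
  \<open>V\<close> of \<open>G\<close>. Pairing \<open>v\<close> with the columns of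
  \<open>V\<close> gives its coefficients in the basis formed by the rows of \<open>G\<close>, so
  the kernel condition kills the last \<open>k\<close> of them.\<close>

lemma exists_kernel_coordinates:
  fixes G :: "nat \<Rightarrow> nat \<Rightarrow> real"
  assumes "rows_independent G m {..<m}" and "k \<le> m"
  shows "\<exists>p :: nat \<Rightarrow> nat \<Rightarrow> real. \<forall>v. (\<forall>a<k. (\<Sum>i<m. v i * p i a) = 0) \<longrightarrow>
           (\<exists>c. \<forall>i<m. v i = (\<Sum>r<m - k. c r * G r i))"
proof -
  obtain V where V: "\<And>i c. i < m \<Longrightarrow> c < m \<Longrightarrow> (\<Sum>r<m. V i r * G r c) = (if i = c then 1 else 0)"
    using rows_independent_square_left_inverse[OF assms(1)] by blast
  show ?thesis
  proof (intro exI[of _ "\<lambda>i a. V i (m - k + a)"] allI impI)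
    fix v :: "nat \<Rightarrow> real" assume v: "\<forall>a<k. (\<Sum>i<m. v i * V i (m - k + a)) = 0"
    define c where "c r = (\<Sum>i<m. v i * V i r)" for r
    have c0: "c r = 0" if "m - k \<le> r" "r < m" for r
      using v[rule_format, of "r - (m - k)"] that unfolding c_def by simp
    have "v j = (\<Sum>r<m - k. c r * G r j)" if j: "j < m" for j
    proof -
      have "v j = (\<Sum>i<m. v i * (\<Sum>r<m. V i r * G r j))"
        using j by (simp add: V if_distrib[of "\<lambda>t. _ * t"] cong: if_cong)
      also have "\<dots> = (\<Sum>r<m. c r * G r j)"
        unfolding c_def sum_distrib_left sum_distrib_right
        by (subst sum.swap) (simp add: mult_ac)
      also have "\<dots> = (\<Sum>r<m - k. c r * G r j)"
        using c0 by (intro sum.mono_neutral_right) auto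
      finally show ?thesis .
    qed
    then show "\<exists>c. \<forall>i<m. v i = (\<Sum>r<m - k. c r * G r i)" by blast
  qed
qed

section \<open>Stresses of count-sparse edge sets\<close>

definition nbrs :: "(nat \<times> nat) set \<Rightarrow> nat \<Rightarrow> nat set" where
  "nbrs F j = {i. (i, j) \<in> F}"

text \<open>
  Restricting the Laman-type count \<open>|F \<inter> (X \<times> Y)| \<le> |X| + k |Y| - k\<close> to neighbourhoods of size at
  least \<open>k\<close> and to their union \<open>X\<close> loses nothing.
\<close>

definition count_sparse :: "nat \<Rightarrow> nat \<Rightarrow> (nat \<times> nat) set \<Rightarrow> bool" where
  "count_sparse k n F \<longleftrightarrow>
     (\<forall>Y\<subseteq>{..<n}. Y \<noteq> {} \<longrightarrow> (\<forall>j\<in>Y. k \<le> card (nbrs F j)) \<longrightarrow>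
        (\<Sum>j\<in>Y. card (nbrs F j)) + k \<le> card (\<Union>j\<in>Y. nbrs F j) + k * card Y)"

lemma nbrs_subset: "F \<subseteq> K_edges m n \<Longrightarrow> nbrs F j \<subseteq> {..<m}"
  by (auto simp: nbrs_def K_edges_def)

text \<open>Separates the column conditions by vertex. Extending the stress by zero outside
  \<open>F\<close> turns sums over edges into full double sums; with one column per
  \<open>u_i\<close> the first conditions couple the vectors \<open>v j\<close>, while the others
  concern each \<open>v j\<close> alone.\<close>

lemma rigidity_matrix_stress_iff:
  fixes v :: "nat \<Rightarrow> nat \<Rightarrow> real"
  assumes "0 < k" and F: "F \<subseteq> K_edges m n"
    and v: "\<And>i j. v j i = (if (i, j) \<in> F then s (i, j) else 0)"
  shows "(\<forall>c<1 * m + k * n. (\<Sum>e\<in>F. s e * rigidity_matrix k 1 m p q e c) = 0) \<longleftrightarrow>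
    (\<forall>i<m. (\<Sum>j<n. v j i * q j 0) = 0) \<and> (\<forall>j<n. \<forall>a<k. (\<Sum>i<m. v j i * p i a) = 0)"
proof -
  have sum: "(\<Sum>e\<in>F. s e * rigidity_matrix k 1 m p q e c)
      = (\<Sum>i<m. \<Sum>j<n. v j i * rigidity_matrix k 1 m p q (i, j) c)" for c
  proof -
    have "(\<Sum>e\<in>F. s e * rigidity_matrix k 1 m p q e c)
        = (\<Sum>(i, j)\<in>{..<m} \<times> {..<n}. v j i * rigidity_matrix k 1 m p q (i, j) c)"
      using F unfolding K_edges_def by (intro sum.mono_neutral_cong_left) (auto simp: v)
    then show ?thesis by (simp add: sum.cartesian_product)
  qed
  have U: "(\<Sum>e\<in>F. s e * rigidity_matrix k 1 m p q e c) = (\<Sum>j<n. v j c * q j 0)" if "c < m" for c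
  proof -
    have "(\<Sum>j<n. v j i * rigidity_matrix k 1 m p q (i, j) c)
        = (if i = c then \<Sum>j<n. v j c * q j 0 else 0)" for i
      using that by (auto simp: rigidity_matrix_def)
    then show ?thesis unfolding sum using that by simp
  qed
  have W: "(\<Sum>e\<in>F. s e * rigidity_matrix k 1 m p q e (m + k * j + a)) = (\<Sum>i<m. v j i * p i a)"
    if "j < n" "a < k" for j a
  proof -
    have "v j' i * rigidity_matrix k 1 m p q (i, j') (m + k * j + a)
        = (if j' = j then v j i * p i a else 0)" for i j'
      using that by (auto simp: rigidity_matrix_def)
    then show ?thesis unfolding sum using that by simp
  qed
  have W_col: "m + k * j + a < 1 * m + k * n" if "j < n" "a < k" for j a
  proof -
    have "k * j + a < k * Suc j" using that by simp
    also have "\<dots> \<le> k * n" using that by (intro mult_le_mono2) simp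
    finally show ?thesis by simp
  qed
  have col: "\<exists>j<n. \<exists>a<k. c = m + k * j + a" if "c < 1 * m + k * n" "\<not> c < m" for c
  proof (intro exI conjI)
    show "(c - m) div k < n"
      using that assms(1) by (subst div_less_iff_less_mult) (auto simp: mult.commute)
    show "(c - m) mod k < k" using assms(1) by simp
    show "c = m + k * ((c - m) div k) + (c - m) mod k" using that by simp
  qed
  show ?thesis
  proof (intro iffI conjI allI impI)
    fix c
    assume R: "(\<forall>i<m. (\<Sum>j<n. v j i * q j 0) = 0) \<and> (\<forall>j<n. \<forall>a<k. (\<Sum>i<m. v j i * p i a) = 0)"
      and c: "c < 1 * m + k * n"
    show "(\<Sum>e\<in>F. s e * rigidity_matrix k 1 m p q e c) = 0"
    proof (cases "c < m")
      case True
      then show ?thesis using U R by simp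
    next
      case False
      then obtain j a where "j < n" "a < k" "c = m + k * j + a" using col[OF c] by blast
      then show ?thesis using W R by simp
    qed
  next
    fix i assume L: "\<forall>c<1 * m + k * n. (\<Sum>e\<in>F. s e * rigidity_matrix k 1 m p q e c) = 0" and "i < m"
    then show "(\<Sum>j<n. v j i * q j 0) = 0" using U[of i] by (simp add: trans_less_add1)
  next
    fix j a assume L: "\<forall>c<1 * m + k * n. (\<Sum>e\<in>F. s e * rigidity_matrix k 1 m p q e c) = 0"
      and ja: "j < n" "a < k"
    show "(\<Sum>i<m. v j i * p i a) = 0" using W[OF ja] L W_col[OF ja] by metis
  qed
qed

text \<open>
  A stress is a family of kernel vectors \<open>v j\<close> of \<open>p\<close>, supported on \<open>nbrs F j\<close>, with sum zero. For
  \<open>p\<close> with kernel the span of the first \<open>m - k\<close> rows of \<open>G\<close>, the vector \<open>v j\<close> only involves the rows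
  of block \<open>j\<close>, and distinct blocks are disjoint.
\<close>

lemma count_sparse_independent_somewhere:
  assumes k: "0 < k" "k \<le> m" and F: "F \<subseteq> K_edges m n" and sparse: "count_sparse k n F"
  shows "\<exists>p. rows_independent (rigidity_matrix k 1 m p (\<lambda>_ _. 1)) (1 * m + k * n) F"
proof -
  have "\<exists>own (G :: nat \<Rightarrow> nat \<Rightarrow> real).
    (\<forall>r c. own r < n \<longrightarrow> c \<notin> nbrs F (own r) \<longrightarrow> G r c = 0) \<and>
    rows_independent G m {..<m} \<and>
    (\<forall>j<n. rows_independent (\<lambda>r c. if c \<in> nbrs F j then 0 else G r c) m
       {r. r < m - k \<and> own r \<noteq> j})"
    using k(2) nbrs_subset[OF F] sparse unfolding count_sparse_def
    by (intro exists_matrix_with_supports) auto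
  then obtain own and G :: "nat \<Rightarrow> nat \<Rightarrow> real" where
    G: "\<And>r c. own r < n \<Longrightarrow> c \<notin> nbrs F (own r) \<Longrightarrow> G r c = 0"
       "rows_independent G m {..<m}"
       "\<And>j. j < n \<Longrightarrow> rows_independent (\<lambda>r c. if c \<in> nbrs F j then 0 else G r c) m
         {r. r < m - k \<and> own r \<noteq> j}"
    by blast
  obtain p where p: "\<And>v. (\<forall>a<k. (\<Sum>i<m. v i * p i a) = 0) \<Longrightarrow>
      \<exists>c. \<forall>i<m. v i = (\<Sum>r<m - k. c r * G r i)"
    using exists_kernel_coordinates[OF G(2) k(2)] by blast
  have "rows_independent (rigidity_matrix k 1 m p (\<lambda>_ _. 1)) (1 * m + k * n) F"
    unfolding rows_independent_def
  proof (rule allI, rule impI)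
    fix s
    assume s: "\<forall>c<1 * m + k * n. (\<Sum>e\<in>F. s e * rigidity_matrix k 1 m p (\<lambda>_ _. 1) e c) = 0"
    define v where "v j i = (if (i, j) \<in> F then s (i, j) else 0)" for i j
    have v: "\<forall>i<m. (\<Sum>j<n. v j i * 1) = 0" "\<forall>j<n. \<forall>a<k. (\<Sum>i<m. v j i * p i a) = 0"
      using rigidity_matrix_stress_iff[OF k(1) F v_def, of p "\<lambda>_ _. 1"] s by blast+
    have "\<exists>c. \<forall>i<m. v j i = (\<Sum>r<m - k. c r * G r i)" if "j < n" for j
      using p[of "v j"] v(2) that by blast
    then obtain c where c: "\<And>j i. j < n \<Longrightarrow> i < m \<Longrightarrow> v j i = (\<Sum>r<m - k. c j r * G r i)"
      by metis
    \<comment> \<open>Off \<open>nbrs F j\<close> both \<open>v j\<close> and the rows of block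
      \<open>j\<close> vanish. What remains is a relation between the masked rows of the other
      blocks, which are independent.\<close>
    have c0: "c j r = 0" if j: "j < n" and r: "r < m - k" "own r \<noteq> j" for j r
    proof -
      let ?R = "{r. r < m - k \<and> own r \<noteq> j}"
      have "(\<Sum>r\<in>?R. c j r * (if i \<in> nbrs F j then 0 else G r i)) = 0" if i: "i < m" for i
      proof (cases "i \<in> nbrs F j")
        case False
        then have "0 = v j i" by (simp add: v_def nbrs_def)
        also have "\<dots> = (\<Sum>r<m - k. c j r * G r i)" by (rule c[OF j i])
        also have "\<dots> = (\<Sum>r\<in>?R. c j r * G r i)"
          using G(1)[of _ i] j False by (intro sum.mono_neutral_right) auto
        finally show ?thesis using False by simp
      qed simp
      then have "\<forall>r\<in>?R. c j r = 0" using G(3)[OF j] unfolding rows_independent_def by blast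
      then show ?thesis using r by simp
    qed
    \<comment> \<open>The vectors \<open>v j\<close> sum to zero, so \<open>d\<close>, padded by
      zero on the completing rows, is a relation between the rows of \<open>G\<close>. By
      \<open>c0\<close> at most one \<open>j\<close> contributes to each \<open>d r\<close>, hence
      every single coefficient vanishes.\<close>
    define d where "d r = (if r < m - k then \<Sum>j<n. c j r else 0)" for r
    have "(\<Sum>r<m. d r * G r i) = 0" if i: "i < m" for i
    proof -
      have "(\<Sum>r<m. d r * G r i) = (\<Sum>r<m - k. (\<Sum>j<n. c j r) * G r i)"
        by (intro sum.mono_neutral_cong_right) (auto simp: d_def)
      also have "\<dots> = (\<Sum>j<n. \<Sum>r<m - k. c j r * G r i)"
        by (subst sum.swap) (simp add: sum_distrib_right)
      also have "\<dots> = (\<Sum>j<n. v j i)" using c i by simp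
      finally show ?thesis using v(1) i by simp
    qed
    then have d0: "\<forall>r\<in>{..<m}. d r = 0" using G(2) unfolding rows_independent_def by blast
    have "c j r = 0" if j: "j < n" and r: "r < m - k" for j r
    proof (cases "own r = j")
      case True
      have "(\<Sum>i<n. c i r) = (\<Sum>i<n. if i = j then c j r else 0)"
        using c0 r True by (intro sum.cong) auto
      also have "\<dots> = c j r" using j by simp
      finally show ?thesis using d0[rule_format, of r] r by (simp add: d_def)
    qed (rule c0[OF j r])
    then have "v j i = 0" if "j < n" "i < m" for j i using c[OF that] that by simp
    then show "\<forall>e\<in>F. s e = 0" using F unfolding v_def K_edges_def by fastforce
  qed
  then show ?thesis by blast
qed

text \<open>The polynomial testing independence of \<open>F\<close> is non-zero at the special
  \<open>p0\<close> with all coordinates of \<open>q\<close> equal to 1, hence also at the generic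
  pair.\<close>

lemma count_sparse_independent_generic:
  assumes k: "0 < k" "k \<le> m" and F: "F \<subseteq> K_edges m n" and sparse: "count_sparse k n F"
    and gen: "generic_pair k 1 m n p q"
  shows "F \<in> rigidity_matroid k 1 m n p q"
proof -
  let ?I = "({..<m} \<times> {..<k}) <+> ({..<n} \<times> {..<1::nat})"
  let ?M = "\<lambda>x. rigidity_matrix k 1 m (\<lambda>i a. x (Inl (i, a))) (\<lambda>j b. x (Inr (j, b)))"
  let ?N = "1 * m + k * n"
  obtain p0 where p0: "rows_independent (rigidity_matrix k 1 m p0 (\<lambda>_ _. 1)) ?N F"
    using count_sparse_independent_somewhere[OF k F sparse] by blast
  have "finite F" using F unfolding K_edges_def by (rule finite_subset) simp
  moreover have "rat_poly_fun ?I (\<lambda>x. ?M x e c)" if e: "e \<in> F" for e c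
  proof -
    obtain i j where ij: "e = (i, j)" "i < m" "j < n" using e F unfolding K_edges_def by auto
    have "Inl (i, (c - m) mod k) \<in> ?I" "Inr (j, 0) \<in> ?I" using ij k(1) by auto
    then show ?thesis
      unfolding ij(1) rigidity_matrix_def prod.case
      by (intro rat_poly_fun_if rat_poly_fun_0 rat_poly_fun.var) simp_all
  qed
  ultimately obtain f where f: "rat_poly_fun ?I f" "\<And>x. f x \<noteq> 0 \<longleftrightarrow> rows_independent (?M x) ?N F"
    using rows_independent_rat_poly_fun[of F ?N ?I ?M] by blast
  have "f (case_sum (\<lambda>(i, a). p0 i a) (\<lambda>_. 1)) \<noteq> 0" using p0 by (subst f(2)) simp
  then have "f (case_sum (\<lambda>(i, a). p i a) (\<lambda>(j, b). q j b)) \<noteq> 0"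
    using rat_poly_fun_nonzero_at_alg_indep[OF f(1)] gen unfolding generic_pair_def by blast
  then have "rows_independent (rigidity_matrix k 1 m p q) ?N F" by (subst (asm) f(2)) simp
  then show ?thesis using F unfolding rigidity_matroid_def by simp
qed

section \<open>Comparison with rooted matroids\<close>

lemma rooted_K_matroid_count_sparse:
  assumes M: "rooted_K_matroid (k + 1) 2 m n \<I>" and F: "F \<in> \<I>"
  shows "count_sparse k n F"
  unfolding count_sparse_def
proof (intro allI impI)
  fix Y assume Y: "Y \<subseteq> {..<n}" "Y \<noteq> {}" "\<forall>j\<in>Y. k \<le> card (nbrs F j)"
  have mat: "matroid_on (K_edges m n) \<I>"
    using M unfolding rooted_K_matroid_def rooted_matroid_def by blast
  then have FK: "F \<subseteq> K_edges m n" using F unfolding matroid_on_def by blast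
  let ?X = "\<Union>j\<in>Y. nbrs F j"
  \<comment> \<open>The rank bound is applied to the edges of \<open>F\<close> at \<open>Y\<close>;
    their number is the degree sum because the stars of distinct \<open>j\<close> are
    disjoint.\<close>
  let ?J = "\<Union>j\<in>Y. (\<lambda>i. (i, j)) ` nbrs F j"
  have X: "?X \<subseteq> {..<m}" using nbrs_subset[OF FK] by blast
  have finn: "finite (nbrs F j)" for j using nbrs_subset[OF FK] finite_subset by blast
  have finY: "finite Y" using Y(1) finite_subset by blast
  obtain j where j: "j \<in> Y" using Y(2) by blast
  have "k \<le> card (nbrs F j)" using Y(3) j by blast
  also have "\<dots> \<le> card ?X" using j finn finY by (intro card_mono) auto
  finally have kX: "k \<le> card ?X" .
  have "?J \<subseteq> F" by (auto simp: nbrs_def)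
  then have J: "?J \<in> \<I>" using mat F unfolding matroid_on_def by blast
  have "card ?J = (\<Sum>j\<in>Y. card ((\<lambda>i. (i, j)) ` nbrs F j))"
    using finn finY by (intro card_UN_disjoint) auto
  also have "\<dots> = (\<Sum>j\<in>Y. card (nbrs F j))"
    by (intro sum.cong card_image) (auto simp: inj_on_def)
  finally have "card ?J = (\<Sum>j\<in>Y. card (nbrs F j))" .
  moreover have "card ?J + k \<le> card ?X + k * card Y"
    using J by (intro rooted_K_matroid_rank_bound[OF M X kX Y(1,2)]) auto
  ultimately show "(\<Sum>j\<in>Y. card (nbrs F j)) + k \<le> card ?X + k * card Y" by simp
qed

text \<open>A single vertex gives equality in the count. For both vertices of \<open>Y\<close>,
  inclusion-exclusion reduces it to at most \<open>k\<close> common neighbours, which the missing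
  edge guarantees.\<close>

lemma count_sparse_proper_subset_rectangle:
  assumes "0 < k" and "card X = k + 1" and "card Y = 2" and "D \<subset> X \<times> Y"
  shows "count_sparse k n D"
  unfolding count_sparse_def
proof (intro allI impI)
  fix Y' assume Y': "Y' \<subseteq> {..<n}" "Y' \<noteq> {}" "\<forall>j\<in>Y'. k \<le> card (nbrs D j)"
  have fin: "finite X" "finite Y"
    using assms(2,3) by (metis add_is_0 card.infinite one_neq_zero, metis card.infinite zero_neq_numeral)
  have sub: "nbrs D j \<subseteq> X" for j using assms(4) by (auto simp: nbrs_def)
  have finn: "finite (nbrs D j)" for j using sub fin(1) finite_subset by blast
  have "Y' \<subseteq> Y"
  proof
    fix j assume "j \<in> Y'"
    then have "nbrs D j \<noteq> {}" using Y'(3) assms(1) by fastforce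
    then show "j \<in> Y" using assms(4) by (auto simp: nbrs_def)
  qed
  obtain y z where yz: "Y = {y, z}" "y \<noteq> z" using assms(3) by (meson card_2_iff)
  consider j where "Y' = {j}" | "Y' = {y, z}" using \<open>Y' \<subseteq> Y\<close> Y'(2) yz by blast
  then show "(\<Sum>j\<in>Y'. card (nbrs D j)) + k \<le> card (\<Union>j\<in>Y'. nbrs D j) + k * card Y'"
  proof cases
    case 1
    then show ?thesis by simp
  next
    case 2
    have "nbrs D y \<inter> nbrs D z \<subset> X"
    proof -
      have "X \<times> Y \<subseteq> D" if "X \<subseteq> nbrs D y \<inter> nbrs D z"
        using that yz by (auto simp: nbrs_def)
      then show ?thesis using sub assms(4) by blast
    qed
    then have "card (nbrs D y \<inter> nbrs D z) < card X"
      by (rule psubset_card_mono[OF fin(1)])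
    then have "card (nbrs D y \<inter> nbrs D z) \<le> k" using assms(2) by simp
    then show ?thesis
      using 2 yz(2) card_Un_Int[OF finn[of y] finn[of z]] by simp
  qed
qed

text \<open>The \<open>k + 1\<close> points of \<open>X\<close> in \<open>k\<close>-space satisfy a
  linear relation \<open>l\<close>. Placing \<open>l\<close> on the star of one vertex and
  \<open>-l\<close> on the star of the other, each divided by the value of \<open>q\<close> there,
  gives a nonzero stress.\<close>

lemma rigidity_matroid_rectangle_dependent:
  assumes k: "0 < k" and X: "X \<subseteq> {..<m}" "card X = k + 1" and Y: "Y \<subseteq> {..<n}" "card Y = 2"
    and q: "\<And>j. j < n \<Longrightarrow> q j 0 \<noteq> 0"
  shows "X \<times> Y \<notin> rigidity_matroid k 1 m n p q"
proof
  assume "X \<times> Y \<in> rigidity_matroid k 1 m n p q"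
  then have ind: "rows_independent (rigidity_matrix k 1 m p q) (1 * m + k * n) (X \<times> Y)"
    by (simp add: rigidity_matroid_def)
  obtain y z where yz: "Y = {y, z}" "y \<noteq> z" using Y(2) by (meson card_2_iff)
  have finX: "finite X" using X(1) finite_subset by blast
  obtain l where l: "\<exists>i\<in>X. l i \<noteq> 0" "\<forall>a\<in>{..<k}. (\<Sum>i\<in>X. l i * p i a) = 0"
    using homogeneous_system_nontrivial_solution[of "{..<k}" X p] finX X(2) by auto
  define s where "s e = (if snd e = y then l (fst e) / q y 0 else - l (fst e) / q z 0)" for e
  define v where "v j i = (if (i, j) \<in> X \<times> Y then s (i, j) else 0)" for i j
  have yzn: "y < n" "z < n" using Y(1) yz by auto
  have "(\<Sum>j<n. v j i * q j 0) = 0" for i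
  proof -
    have "(\<Sum>j<n. v j i * q j 0) = (\<Sum>j\<in>{y, z}. v j i * q j 0)"
      using yz yzn by (intro sum.mono_neutral_right) (auto simp: v_def)
    also have "\<dots> = 0" using yz yzn q by (simp add: v_def s_def)
    finally show ?thesis .
  qed
  moreover have "(\<Sum>i<m. v j i * p i a) = 0" if "a < k" for j a
  proof -
    define w where "w = (if j = y then 1 / q y 0 else if j = z then - 1 / q z 0 else 0)"
    have "(\<Sum>i<m. v j i * p i a) = (\<Sum>i\<in>X. w * (l i * p i a))"
      using X(1) yz by (intro sum.mono_neutral_cong_right) (auto simp: v_def s_def w_def)
    also have "\<dots> = 0" using l(2) that by (simp flip: sum_distrib_left)
    finally show ?thesis .
  qed
  ultimately have "\<forall>c<1 * m + k * n. (\<Sum>e\<in>X \<times> Y. s e * rigidity_matrix k 1 m p q e c) = 0"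
    using X(1) Y(1)
    by (subst rigidity_matrix_stress_iff[OF k _ v_def]) (auto simp: K_edges_def)
  then have s0: "\<forall>e\<in>X \<times> Y. s e = 0" using ind unfolding rows_independent_def by blast
  obtain i where i: "i \<in> X" "l i \<noteq> 0" using l(1) by blast
  then have "s (i, y) = 0" using s0 yz by simp
  then show False using i(2) q[OF yzn(1)] by (simp add: s_def)
qed

lemma rigidity_matroid_rooted_K_matroid:
  assumes k: "0 < k" "k \<le> m" and gen: "generic_pair k 1 m n p q"
  shows "rooted_K_matroid (k + 1) 2 m n (rigidity_matroid k 1 m n p q)"
  unfolding rooted_K_matroid_def rooted_matroid_def
proof (intro conjI allI impI)
  show "matroid_on (K_edges m n) (rigidity_matroid k 1 m n p q)"
    unfolding rigidity_matroid_def by (rule matroid_on_rows_independent) (simp add: K_edges_def)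
next
  fix C assume "rooted_copy_edges {..<k + 1} {..<2} (K_edges (k + 1) 2) m n C"
  then obtain f g where f: "inj_on f {..<k + 1}" "f ` {..<k + 1} \<subseteq> {..<m}"
    and g: "inj_on g {..<2::nat}" "g ` {..<2} \<subseteq> {..<n}" and C: "C = map_prod f g ` K_edges (k + 1) 2"
    unfolding rooted_copy_edges_def by blast
  define X Y where "X = f ` {..<k + 1}" and "Y = g ` {..<2}"
  have CXY: "C = X \<times> Y" unfolding C X_def Y_def K_edges_def by (rule map_prod_surj_on) simp_all
  have X: "X \<subseteq> {..<m}" "card X = k + 1" using f by (auto simp: X_def card_image)
  have Y: "Y \<subseteq> {..<n}" "card Y = 2" using g by (auto simp: Y_def card_image)
  have sub: "C \<subseteq> K_edges m n" using X Y unfolding CXY K_edges_def by auto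
  \<comment> \<open>The coordinate itself is a polynomial that is non-zero at the all-ones point, so
    it cannot vanish at a generic pair.\<close>
  have q: "q j 0 \<noteq> 0" if "j < n" for j
  proof -
    let ?I = "({..<m} \<times> {..<k}) <+> ({..<n} \<times> {..<1::nat})"
    have "rat_poly_fun ?I (\<lambda>x. x (Inr (j, 0)))" using that by (intro rat_poly_fun.var) auto
    from rat_poly_fun_nonzero_at_alg_indep[OF this, of "\<lambda>_. 1"] gen
    show ?thesis unfolding generic_pair_def by fastforce
  qed
  have "D \<in> rigidity_matroid k 1 m n p q" if D: "D \<subset> C" for D
  proof (rule count_sparse_independent_generic[OF k _ _ gen])
    show "D \<subseteq> K_edges m n" using D sub by blast
    show "count_sparse k n D"
      using count_sparse_proper_subset_rectangle[OF k(1) X(2) Y(2)] D unfolding CXY by blast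
  qed
  then show "circuit_of (K_edges m n) (rigidity_matroid k 1 m n p q) C"
    using sub rigidity_matroid_rectangle_dependent[OF k(1) X Y, of q] q unfolding circuit_of_def CXY
    by blast
qed

theorem theorem6p3:
  fixes k m n :: nat and p q :: "nat \<Rightarrow> nat \<Rightarrow> real"
  assumes "k \<ge> 1" and "m \<ge> k + 1" and "n \<ge> 2"
    and "generic_pair k 1 m n p q"
  shows "unique_weak_maximal (rooted_K_matroid (k + 1) 2 m n) (rigidity_matroid k 1 m n p q)"
proof -
  let ?P = "rooted_K_matroid (k + 1) 2 m n" and ?R = "rigidity_matroid k 1 m n p q"
  have k: "0 < k" "k \<le> m" using assms by auto
  have R: "?P ?R" using rigidity_matroid_rooted_K_matroid[OF k assms(4)] .
  \<comment> \<open>The rigidity matroid is the greatest element among the rooted matroids, not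
    merely a maximal one; uniqueness then follows formally.\<close>
  have le: "weak_le \<J> ?R" if J: "?P \<J>" for \<J>
    unfolding weak_le_def
  proof
    fix F assume F: "F \<in> \<J>"
    then have "F \<subseteq> K_edges m n"
      using J unfolding rooted_K_matroid_def rooted_matroid_def matroid_on_def by blast
    then show "F \<in> ?R"
      using count_sparse_independent_generic[OF k _ _ assms(4)]
        rooted_K_matroid_count_sparse[OF J F] by blast
  qed
  have antisym: "\<J> = ?R" if "?P \<J>" "weak_le ?R \<J>" for \<J>
    using le[OF that(1)] that(2) unfolding weak_le_def by blast
  have "weak_maximal ?P ?R" using R antisym unfolding weak_maximal_def by blast
  moreover have "\<J> = ?R" if "weak_maximal ?P \<J>" for \<J>
    using that R le unfolding weak_maximal_def by blast
  ultimately show ?thesis unfolding unique_weak_maximal_def by blast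
qed

end
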